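(* For every square-free $\mathfrak q\ge 1$, $$\mathcal{M}_{\mathfrak q}=\beta(\mathfrak q)\,|\Pi|+r^{(1)}(\mathfrak q),$$ where $\beta$ is the multiplicative function on square-free integers given on primes by $\beta(2)=\frac13$, $\beta(p)=\frac{2(2p-1)}{p(p+1)}$ if $p\equiv1\bmod 4$, and $\beta(p)=\frac{2}{p(p-1)}$ if $p\equiv 3\bmod 4$; and for every $\varepsilon>0$ and every $\mathcal{Q}\ge1$, $$\sum_{\substack{\mathfrak q<\mathcal{Q}\\ \mathfrak q\text{ square-free}}}|r^{(1)}(\mathfrak q)|\ll_{\varepsilon} |\Pi|\,\mathcal{Q}^{\varepsilon}\,Q_0^{C_0}\,Y^{-\Theta},$$ where $C_0,\Theta$ are the absolute constants in the equidistribution property of $\aleph$ below.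
   Context: Fix an integer $\mathcal{A}\ge1$; $\Gamma_{\mathcal{A}}$ is the semigroup of all products of even length of the matrices $\begin{pmatrix}a&1\\1&0\end{pmatrix}$, $1\le a\le \mathcal{A}$, and $\delta=\delta_{\mathcal{A}}$ is the Hausdorff dimension of the set of $[0;a_1,a_2,\dots]$ with all $a_j\le\mathcal{A}$. $\|g\|=\sqrt{\mathrm{tr}(g\,{}^tg)}$, $B_X=\{g:\|g\|<X\}$, ${}^t$ is transpose, and $\mathfrak f(\varphi)=a^2+b^2+c^2+d^2$ for $\varphi=\begin{pmatrix}a&b\\c&d\end{pmatrix}$. Parameters $X,Y,Z\ge1$ with $XYZ=N$, and $Q_0\ge1$. Fix absolute constants $C_0,\Theta>0$ and a nonempty set $\aleph\subset\{\gamma\in\Gamma_2:\|\gamma\|<Y\}$ with $\#\{\mathfrak a\in\aleph:\mathfrak a\equiv\mathfrak a_0 \bmod q\}=|\aleph|/|\mathrm{SL}_2(\mathbb{Z}/q)|+O(|\aleph|q^{C_0}Y^{-\Theta})$ for all $q\ge1$, $\mathfrak a_0\in\mathrm{SL}_2(\mathbb{Z}/q)$, with absolute implied constant (such sets exist by known spectral gap results). $\Omega_X\subset\Gamma_{\mathcal{A}}\cap B_X$ is a subset all of whose elements have the same word length, with $\#\Omega_X\gg X^{2\delta}/\log X$; similarly $\Omega_Z$; $\Pi=\Omega_X\cdot\aleph\cdot\Omega_Z$. For a prime $p$, $\rho(p)=|\mathrm{SL}_2(\mathbb{F}_p)|^{-1}\#\{\gamma\in\mathrm{SL}_2(\mathbb{F}_p):\mathfrak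 f(\gamma)\equiv2\bmod p\}$ (explicitly $\rho(2)=1/3$, $\rho(p)=(2p-1)/(p(p+1))$ for $p\equiv1\bmod4$, $\rho(p)=1/(p(p-1))$ for $p\equiv3\bmod4$), extended multiplicatively to square-free integers; $\Xi(p;n)=\mathbf 1_{\{n\equiv0\bmod p\}}-\rho(p)$, extended to square-free $q$ by $\Xi(q;n)=\prod_{p\mid q}\Xi(p;n)$. For square-free $\mathfrak q$, $$\mathcal{M}_{\mathfrak q}=\sum_{\substack{q\mid\mathfrak q\\ q<Q_0}}\ \sum_{\substack{\tau \bmod \mathfrak q\\ \tau^2\equiv4 \bmod \mathfrak q}}\ \sum_{\varphi\in\Pi}\Xi\big(q;\mathfrak f(\varphi)-\tau\big)\,\rho(\mathfrak q/q).$$ Implied constants may depend on $\mathcal{A}$ and $\varepsilon$.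
   Formalization: Proved with Q_0 > 1 (at Q_0 = 1 the sum defining M_q is empty and the bound fails) and with Q_0^{C_0+3} in place of Q_0^{C_0}, C_0 being the exponent in the per-class equidistribution of ℵ; with the same C_0 the bound is false in general. *)

theory Defs
  imports
    "HOL-Analysis.Analysis"
    "HOL-Number_Theory.Number_Theory"
    "HOL-Computational_Algebra.Squarefree"
begin

definition hausdorff_premeasure :: "real \<Rightarrow> real \<Rightarrow> real set \<Rightarrow> ennreal" where
  "hausdorff_premeasure s d S =
     Inf {(\<Sum>n. ennreal (diameter (U n) powr s)) | U :: nat \<Rightarrow> real set.
            S \<subseteq> (\<Union>n. U n) \<and> (\<forall>n. bounded (U n) \<and> diameter (U n) \<le> d)}"

definition hausdorff_measure :: "real \<Rightarrow> real set \<Rightarrow> ennreal" where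
  "hausdorff_measure s S = (SUP d\<in>{0<..}. hausdorff_premeasure s d S)"

text \<open>The infimum is over \<open>s > 0\<close> because \<open>0 powr 0 = 0\<close> makes \<open>hausdorff_measure 0\<close> differ from
  counting measure; this does not change the value of the infimum.\<close>

definition hausdorff_dim :: "real set \<Rightarrow> real" where
  "hausdorff_dim S = Inf {s. s > 0 \<and> hausdorff_measure s S = 0}"

text \<open>\<open>cfrac [a\<^sub>1, \<dots>, a\<^sub>n]\<close> is the finite continued fraction \<open>[0; a\<^sub>1, \<dots>, a\<^sub>n]\<close>.\<close>

fun cfrac :: "nat list \<Rightarrow> real" where
  "cfrac [] = 0"
| "cfrac (a # w) = 1 / (real a + cfrac w)"

definition cfrac_set :: "nat \<Rightarrow> real set" where
  "cfrac_set A = {x. \<exists>a :: nat \<Rightarrow> nat. (\<forall>j. 1 \<le> a j \<and> a j \<le> A) \<and>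
                      (\<lambda>n. cfrac (map a [0..<n])) \<longlonglongrightarrow> x}"

definition delta_dim :: "nat \<Rightarrow> real" where
  "delta_dim A = hausdorff_dim (cfrac_set A)"

definition gen_mat :: "nat \<Rightarrow> int^2^2" where
  "gen_mat a = vector [vector [int a, 1], vector [1, 0]]"

fun word_mat :: "nat list \<Rightarrow> int^2^2" where
  "word_mat [] = mat 1"
| "word_mat (a # w) = gen_mat a ** word_mat w"

definition Gamma_words :: "nat \<Rightarrow> nat \<Rightarrow> (int^2^2) set" where
  "Gamma_words A l = {word_mat w | w. length w = l \<and> set w \<subseteq> {1..A}}"

text \<open>A semigroup, not a monoid: the empty word is excluded.\<close>

definition Gamma_semi :: "nat \<Rightarrow> (int^2^2) set" where
  "Gamma_semi A = (\<Union>l\<in>{l. even l \<and> l > 0}. Gamma_words A l)"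

definition frob_norm :: "int^2^2 \<Rightarrow> real" where
  "frob_norm g = sqrt (real_of_int (trace (g ** transpose g)))"

definition norm_ball :: "real \<Rightarrow> (int^2^2) set" where
  "norm_ball X = {g. frob_norm g < X}"

definition ff :: "int^2^2 \<Rightarrow> int" where
  "ff g = (g $ 1 $ 1)\<^sup>2 + (g $ 1 $ 2)\<^sup>2 + (g $ 2 $ 1)\<^sup>2 + (g $ 2 $ 2)\<^sup>2"

text \<open>\<open>SL\<^sub>2(\<int>/q)\<close>, each residue matrix being represented by its entries in \<open>{0..<q}\<close>.\<close>

definition SL2_mod :: "nat \<Rightarrow> (int^2^2) set" where
  "SL2_mod q = {g. (\<forall>i j. g $ i $ j \<in> {0..<int q}) \<and> [det g = 1] (mod int q)}"

definition mat_cong :: "nat \<Rightarrow> int^2^2 \<Rightarrow> int^2^2 \<Rightarrow> bool" where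
  "mat_cong q g h \<longleftrightarrow> (\<forall>i j. [g $ i $ j = h $ i $ j] (mod int q))"

definition equidistributed :: "real \<Rightarrow> real \<Rightarrow> real \<Rightarrow> real \<Rightarrow> (int^2^2) set \<Rightarrow> bool" where
  "equidistributed C0 \<Theta> K Y \<AA> \<longleftrightarrow>
     (\<forall>q\<ge>1. \<forall>a0\<in>SL2_mod q.
        \<bar>real (card {a\<in>\<AA>. mat_cong q a a0}) - real (card \<AA>) / real (card (SL2_mod q))\<bar>
          \<le> K * real (card \<AA>) * real q powr C0 * Y powr (-\<Theta>))"

text \<open>The conditions on \<open>\<Omega>\<^sub>X\<close> and \<open>\<Omega>\<^sub>Z\<close>; \<open>c\<close> is the constant implied in the lower bound.\<close>

definition Omega_set :: "nat \<Rightarrow> real \<Rightarrow> real \<Rightarrow> (int^2^2) set \<Rightarrow> bool" where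
  "Omega_set A c X \<Omega> \<longleftrightarrow>
     \<Omega> \<subseteq> Gamma_semi A \<inter> norm_ball X \<and>
     (\<exists>l. \<Omega> \<subseteq> Gamma_words A l) \<and>
     real (card \<Omega>) \<ge> c * (X powr (2 * delta_dim A) / ln X)"

definition prod_set :: "(int^2^2) set \<Rightarrow> (int^2^2) set \<Rightarrow> (int^2^2) set \<Rightarrow> (int^2^2) set" where
  "prod_set \<Omega>X \<AA> \<Omega>Z = {x ** a ** z | x a z. x \<in> \<Omega>X \<and> a \<in> \<AA> \<and> z \<in> \<Omega>Z}"

definition rho_prime :: "nat \<Rightarrow> real" where
  "rho_prime p = real (card {g\<in>SL2_mod p. [ff g = 2] (mod int p)}) / real (card (SL2_mod p))"

definition rho :: "nat \<Rightarrow> real" where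
  "rho q = (\<Prod>p\<in>prime_factors q. rho_prime p)"

definition Xi :: "nat \<Rightarrow> int \<Rightarrow> real" where
  "Xi q n = (\<Prod>p\<in>prime_factors q. (of_bool ([n = 0] (mod int p)) - rho_prime p))"

definition beta_prime :: "nat \<Rightarrow> real" where
  "beta_prime p =
     (if p = 2 then 1 / 3
      else if [p = 1] (mod 4) then 2 * (2 * real p - 1) / (real p * (real p + 1))
      else 2 / (real p * (real p - 1)))"

definition beta :: "nat \<Rightarrow> real" where
  "beta q = (\<Prod>p\<in>prime_factors q. beta_prime p)"

definition main_M :: "real \<Rightarrow> (int^2^2) set \<Rightarrow> nat \<Rightarrow> real" where
  "main_M Q0 P qq =
     (\<Sum>q\<in>{q. q dvd qq \<and> real q < Q0}.
        \<Sum>\<tau>\<in>{\<tau>. 0 \<le> \<tau> \<and> \<tau> < int qq \<and> [\<tau>\<^sup>2 = 4] (mod int qq)}.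
          \<Sum>\<phi>\<in>P. Xi q (ff \<phi> - \<tau>) * rho (qq div q))"

end

theory Submission
  imports Defs
begin

text \<open>The divisor \<open>q = 1\<close> contributes the main term, since \<open>beta\<close> is \<open>rho\<close> times the number of roots of
  \<open>\<tau>\<^sup>2 = 4\<close>. For a divisor \<open>d > 1\<close>, the sum over \<open>\<phi> = x a z\<close> is, for fixed \<open>x\<close> and \<open>z\<close>, a sum over \<open>a\<close> of
  a function of \<open>a\<close> modulo \<open>d\<close>. Equidistribution replaces it by the sum of \<open>Xi\<close> over \<open>SL\<^sub>2(\<int>/d)\<close>, which
  factors over the primes dividing \<open>d\<close> and vanishes, because \<open>ff = 2\<close> and \<open>ff = -2\<close> have the same number
  of solutions modulo each prime. The error is bounded by the \<open>\<ell>\<^sup>1\<close> norm of \<open>Xi\<close>, which is at most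
  \<open>4\<^bsup>\<omega>(d)\<^esup> d\<^sup>2\<close>. Products \<open>x a z\<close> are counted once since word matrices determine their words.\<close>

section \<open>Conics modulo a prime\<close>

text \<open>\<open>rho_prime\<close> is defined through the residue 2 alone, while
  \<open>\<tau>\<close> runs over all roots of 4. The counts for 2 and -2 agree because each is the
  size of the circle of norm 0 times that of a circle of norm 1 or -1, and for odd p all circles of
  nonzero norm have equally many points. The same evaluation supplies the explicit values behind
  \<open>beta\<close>. The exponent \<open>C0 + 3\<close> of \<open>Q0\<close> has three sources:
  \<open>C0\<close> from equidistribution, 2 from the L1 norm of \<open>Xi\<close> over the residue
  group, and 1 from the number of divisors below \<open>Q0\<close>. The L1 norm is of size d^2, up
  to a factor \<open>4 ^ num_primes d\<close>, although the group has order about d^3, because the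
  indicator in \<open>Xi\<close> has small support and \<open>rho\<close> is small. The condition
  \<open>Q0 > 1\<close> lets the divisor 1 into the sum; at \<open>Q0 = 1\<close> no divisor of a
  square-free modulus would qualify and \<open>main_M\<close> would be 0, without a main
  term.\<close>

lemma card_Collect_bij_betw:
  assumes "bij_betw f A B"
  shows "card {x\<in>A. P (f x)} = card {y\<in>B. P y}"
proof -
  have "f ` {x\<in>A. P (f x)} = {y\<in>B. P y}"
    using assms by (auto simp: bij_betw_def)
  moreover have "inj_on f {x\<in>A. P (f x)}"
    using assms by (auto simp: bij_betw_def inj_on_def)
  ultimately show ?thesis
    by (metis card_image)
qed

lemma residue_eq_iff_cong:
  fixes x y :: int
  assumes "x \<in> {0..<q}" "y \<in> {0..<q}"
  shows "x = y \<longleftrightarrow> [x = y] (mod q)"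
  using assms by (auto simp: cong_def)

text \<open>By Cramer's rule q divides the determinant times each coordinate difference, and the
  determinant cancels since it is a unit modulo q. An injective self-map of a finite set is
  onto.\<close>

lemma bij_betw_linear_residue_pairs:
  fixes a b c d q :: int
  assumes "q > 0" and cop: "coprime (a * d - b * c) q"
  shows "bij_betw (\<lambda>(x, y). ((a * x + b * y) mod q, (c * x + d * y) mod q))
           ({0..<q} \<times> {0..<q}) ({0..<q} \<times> {0..<q})"
proof -
  let ?R = "{0..<q} \<times> {0..<q}" and ?f = "\<lambda>(x, y). ((a * x + b * y) mod q, (c * x + d * y) mod q)"
  have "inj_on ?f ?R"
  proof (rule inj_onI, clarify)
    fix x y x' y' assume xy: "x \<in> {0..<q}" "y \<in> {0..<q}" "x' \<in> {0..<q}" "y' \<in> {0..<q}"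
      and 1: "(a * x + b * y) mod q = (a * x' + b * y') mod q"
      and 2: "(c * x + d * y) mod q = (c * x' + d * y') mod q"
    have c1: "q dvd (a * x + b * y) - (a * x' + b * y')" and c2: "q dvd (c * x + d * y) - (c * x' + d * y')"
      using 1 2 by (simp_all add: mod_eq_dvd_iff)
    have "q dvd d * ((a * x + b * y) - (a * x' + b * y')) - b * ((c * x + d * y) - (c * x' + d * y'))"
      using c1 c2 by (meson dvd_diff dvd_mult)
    also have "\<dots> = (a * d - b * c) * (x - x')" by (simp add: power2_eq_square algebra_simps)
    finally have "q dvd x - x'" using cop by (simp add: coprime_commute coprime_dvd_mult_right_iff)
    moreover have "q dvd a * ((c * x + d * y) - (c * x' + d * y')) - c * ((a * x + b * y) - (a * x' + b * y'))"
      using c1 c2 by (meson dvd_diff dvd_mult)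
    then have "q dvd (a * d - b * c) * (y - y')" by (simp add: algebra_simps)
    then have "q dvd y - y'" using cop by (simp add: coprime_commute coprime_dvd_mult_right_iff)
    ultimately show "x = x' \<and> y = y'"
      using residue_eq_iff_cong[OF xy(1,3)] residue_eq_iff_cong[OF xy(2,4)] by (simp add: cong_iff_dvd_diff)
  qed
  moreover have "?f ` ?R \<subseteq> ?R" using \<open>q > 0\<close> by auto
  ultimately show ?thesis
    by (simp add: bij_betw_def endo_inj_surj)
qed

text \<open>The linear forms are left unreduced inside \<open>P\<close>, so that identities between
  quadratic forms can be applied over the integers.\<close>

lemma card_linear_residue_pairs:
  fixes a b c d q :: int
  assumes "q > 0" "coprime (a * d - b * c) q"
    and "\<And>x y x' y'. [x = x'] (mod q) \<Longrightarrow> [y = y'] (mod q) \<Longrightarrow> P x y \<longleftrightarrow> P x' y'"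
  shows "card {(x, y) \<in> {0..<q} \<times> {0..<q}. P (a * x + b * y) (c * x + d * y)} =
         card {(x, y) \<in> {0..<q} \<times> {0..<q}. P x y}"
proof -
  have "P ((a * x + b * y) mod q) ((c * x + d * y) mod q) \<longleftrightarrow> P (a * x + b * y) (c * x + d * y)" for x y
    by (rule assms(3)) (simp_all add: cong_def)
  then have "{u \<in> {0..<q} \<times> {0..<q}. (\<lambda>(x, y). P x y)
      ((\<lambda>(x, y). ((a * x + b * y) mod q, (c * x + d * y) mod q)) u)} =
    {(x, y) \<in> {0..<q} \<times> {0..<q}. P (a * x + b * y) (c * x + d * y)}"
    by (auto simp del: mod_add_left_eq)
  moreover have "{u \<in> {0..<q} \<times> {0..<q}. (\<lambda>(x, y). P x y) u} = {(x, y) \<in> {0..<q} \<times> {0..<q}. P x y}"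
    by auto
  ultimately show ?thesis
    using card_Collect_bij_betw[OF bij_betw_linear_residue_pairs[OF assms(1,2)], of "\<lambda>(x, y). P x y"]
    by simp
qed

definition hyperbola :: "int \<Rightarrow> int \<Rightarrow> (int \<times> int) set" where
  "hyperbola p k = {(x, y) \<in> {0..<p} \<times> {0..<p}. [x * y = k] (mod p)}"

definition circle :: "int \<Rightarrow> int \<Rightarrow> (int \<times> int) set" where
  "circle p k = {(x, y) \<in> {0..<p} \<times> {0..<p}. [x\<^sup>2 + y\<^sup>2 = k] (mod p)}"

lemma finite_hyperbola [simp]: "finite (hyperbola p k)"
  unfolding hyperbola_def by (rule finite_subset[of _ "{0..<p} \<times> {0..<p}"]) auto

lemma finite_circle [simp]: "finite (circle p k)"
  unfolding circle_def by (rule finite_subset[of _ "{0..<p} \<times> {0..<p}"]) auto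

lemma card_hyperbola_zero:
  fixes p :: nat
  assumes "prime p"
  shows "card (hyperbola p 0) = 2 * p - 1"
proof -
  have p: "prime (int p)" "p > 0" using assms prime_gt_0_nat by auto
  have "hyperbola p 0 = {0} \<times> {0..<int p} \<union> {0<..<int p} \<times> {0}"
  proof -
    have "x = 0 \<or> y = 0" if "x \<in> {0..<int p}" "y \<in> {0..<int p}" "int p dvd x * y" for x y
      using that prime_dvd_mult_iff[OF p(1)] by (auto dest: zdvd_imp_le)
    then have "hyperbola p 0 \<subseteq> {0} \<times> {0..<int p} \<union> {0<..<int p} \<times> {0}"
      unfolding hyperbola_def cong_0_iff by fastforce
    moreover have "{0} \<times> {0..<int p} \<union> {0<..<int p} \<times> {0} \<subseteq> hyperbola p 0"
      using p(2) by (auto simp: hyperbola_def)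
    ultimately show ?thesis by blast
  qed
  also have "card \<dots> = p + (p - 1)"
    by (subst card_Un_disjoint) (auto simp: card_cartesian_product)
  finally show ?thesis using p(2) by simp
qed

text \<open>A product that is nonzero modulo p forces the first coordinate to be a unit, and this
  unit x determines the second coordinate as k/x. So the projection \<open>fst\<close> is a
  bijection onto the units.\<close>

lemma card_hyperbola_nonzero:
  fixes p :: nat
  assumes "prime p" "\<not> int p dvd k"
  shows "card (hyperbola p k) = p - 1"
proof -
  have p: "prime (int p)" "p > 0" using assms prime_gt_0_nat by auto
  have "bij_betw fst (hyperbola p k) {0<..<int p}"
    unfolding bij_betw_def
  proof (intro conjI inj_onI)
    fix u v assume u: "u \<in> hyperbola p k" and v: "v \<in> hyperbola p k" and eq: "fst u = fst v"
    obtain x y y' where uv: "u = (x, y)" "v = (x, y')" using eq by (metis prod.collapse)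
    have xy: "[x * y = k] (mod p)" "[x * y' = k] (mod p)" "y \<in> {0..<int p}" "y' \<in> {0..<int p}"
      using u v by (auto simp: uv hyperbola_def)
    have "\<not> int p dvd x" using xy(1) assms(2) by (metis cong_dvd_iff dvd_mult2)
    then have "coprime x (int p)" using p(1) by (metis coprime_commute prime_imp_coprime)
    moreover have "[x * y = x * y'] (mod p)" using xy by (meson cong_sym cong_trans)
    ultimately have "[y = y'] (mod p)" by (metis cong_mult_lcancel)
    then show "u = v" using residue_eq_iff_cong[OF xy(3,4)] uv by simp
  next
    show "fst ` hyperbola p k = {0<..<int p}"
    proof (intro equalityI subsetI)
      fix x assume "x \<in> fst ` hyperbola p k"
      then obtain y where "x \<in> {0..<int p}" "[x * y = k] (mod p)" by (auto simp: hyperbola_def)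
      moreover have "x \<noteq> 0" using calculation assms(2) by (auto simp: cong_def dvd_eq_mod_eq_0)
      ultimately show "x \<in> {0<..<int p}" by auto
    next
      fix x assume x: "x \<in> {0<..<int p}"
      then have "\<not> int p dvd x" by (auto dest: zdvd_imp_le)
      then have "coprime x (int p)" using p(1) by (metis coprime_commute prime_imp_coprime)
      then obtain z where z: "[x * z = 1] (mod int p)" using cong_solve_coprime_int by blast
      have "[x * ((z * k) mod p) = (x * z) * k] (mod p)" by (simp add: cong_def mod_mult_right_eq mult.assoc)
      also have "[(x * z) * k = 1 * k] (mod p)" by (rule cong_mult[OF z cong_refl])
      finally have "(x, (z * k) mod p) \<in> hyperbola p k" using x p(2) by (auto simp: hyperbola_def)
      then show "x \<in> fst ` hyperbola p k" by force
    qed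
  qed
  then have "card (hyperbola p k) = card {0<..<int p}" by (rule bij_betw_same_card)
  then show ?thesis by simp
qed

text \<open>Euler's criterion at -1: the Legendre symbol is congruent to (-1)^((p-1)/2), and p > 2
  keeps 1 and -1 apart modulo p.\<close>

lemma QuadRes_minus_one_iff:
  fixes p :: nat
  assumes "prime p" "p > 2"
  shows "QuadRes p (-1) \<longleftrightarrow> [p = 1] (mod 4)"
proof -
  have odd: "odd p" using assms prime_odd_nat by auto
  have *: "[Legendre (-1) p = (-1) ^ ((p - 1) div 2)] (mod p)"
    using euler_criterion[OF assms, of "-1"] by simp
  have pm: "\<not> int p dvd 2" "\<not> int p dvd -1" using assms(2) by (auto dest: zdvd_imp_le)
  have L: "Legendre (-1) p = (if QuadRes p (-1) then 1 else -1)"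
    unfolding Legendre_def using pm by (simp add: cong_0_iff)
  have e: "even ((p - 1) div 2) \<longleftrightarrow> [p = 1] (mod 4)"
    using odd unfolding cong_def by presburger
  have n: "\<not> [1 = (-1::int)] (mod p)" "\<not> [(-1::int) = 1] (mod p)"
    using pm by (simp_all add: cong_iff_dvd_diff)
  show ?thesis using * L e n by (auto split: if_splits)
qed

text \<open>With i a square root of -1 modulo p, the sum of squares splits as (x + iy)(x - iy). This
  change of variables has determinant -2i, a unit, and carries the circle to the hyperbola.\<close>

lemma card_circle_1_mod_4:
  fixes p :: nat
  assumes "prime p" "[p = 1] (mod 4)"
  shows "card (circle p k) = card (hyperbola p k)"
proof -
  have "p > 2" using assms prime_gt_1_nat[of p] by (cases "p = 2") (auto simp: cong_def)
  then obtain i where i: "[i\<^sup>2 = -1] (mod int p)"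
    using QuadRes_minus_one_iff assms by (auto simp: QuadRes_def)
  have p: "prime (int p)" using assms by simp
  have "\<not> int p dvd 2" using \<open>p > 2\<close> by (auto dest: zdvd_imp_le)
  moreover have "\<not> int p dvd i"
  proof
    assume "int p dvd i"
    then have "int p dvd i\<^sup>2" by (simp add: power2_eq_square)
    then have "int p dvd -1" using i by (metis cong_dvd_iff)
    then show False using p by simp
  qed
  ultimately have "\<not> int p dvd 1 * (- i) - i * 1"
    using p prime_dvd_mult_iff[OF p, of 2 i] by auto
  then have "coprime (1 * (- i) - i * 1) (int p)" using p by (metis coprime_commute prime_imp_coprime)
  then have "card {(x, y) \<in> {0..<int p} \<times> {0..<int p}. [(1 * x + i * y) * (1 * x + - i * y) = k] (mod p)}
        = card (hyperbola p k)"
    unfolding hyperbola_def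
  proof (intro card_linear_residue_pairs[of _ _ _ _ _ "\<lambda>x y. [x * y = k] (mod p)"])
    fix x y x' y' :: int assume "[x = x'] (mod p)" "[y = y'] (mod p)"
    then have "[x * y = x' * y'] (mod p)" by (rule cong_mult)
    then show "[x * y = k] (mod p) \<longleftrightarrow> [x' * y' = k] (mod p)" by (simp add: cong_def)
  qed (use prime_gt_0_nat[OF assms(1)] in simp)
  moreover have "[(1 * x + i * y) * (1 * x + - i * y) = k] (mod p) \<longleftrightarrow> [x\<^sup>2 + y\<^sup>2 = k] (mod p)" for x y
  proof -
    have "(1 * x + i * y) * (1 * x + - i * y) = x\<^sup>2 - i\<^sup>2 * y\<^sup>2" by (simp add: power2_eq_square algebra_simps)
    moreover have "[x\<^sup>2 - i\<^sup>2 * y\<^sup>2 = x\<^sup>2 - (-1) * y\<^sup>2] (mod p)"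
      by (intro cong_diff cong_mult cong_refl i)
    ultimately show ?thesis by (simp add: cong_def)
  qed
  ultimately show ?thesis by (simp add: circle_def)
qed

text \<open>Pigeonhole: on 0..h with h = (p-1)/2 both x^2 and k - x^2 are injective modulo p, since
  there x + y is at most p - 1. Two sets of (p+1)/2 residues each must meet.\<close>

lemma sum_two_squares_mod_prime:
  fixes p :: nat
  assumes "prime p" "odd p"
  obtains u v where "[u\<^sup>2 + v\<^sup>2 = k] (mod int p)"
proof -
  have p: "prime (int p)" "p > 0" using assms prime_gt_0_nat by auto
  define h where "h = (int p - 1) div 2"
  have h: "2 * h = int p - 1" using assms(2) unfolding h_def by presburger
  then have h0: "h \<ge> 0" using p(2) by linarith
  define S where "S = (\<lambda>x. x\<^sup>2 mod int p) ` {0..h}"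
  define T where "T = (\<lambda>x. (k - x\<^sup>2) mod int p) ` {0..h}"
  have *: "x = y" if "x \<in> {0..h}" "y \<in> {0..h}" and dv: "int p dvd x\<^sup>2 - y\<^sup>2" for x y
  proof -
    have "x\<^sup>2 - y\<^sup>2 = (x - y) * (x + y)" by (simp add: power2_eq_square algebra_simps)
    then consider "int p dvd x - y" | "int p dvd x + y"
      using dv prime_dvd_mult_iff[OF p(1)] by auto
    then show ?thesis
    proof cases
      case 1
      have "\<bar>x - y\<bar> < int p" using that h by auto
      then show ?thesis using 1 dvd_imp_le_int[of "x - y" "int p"] by fastforce
    next
      case 2
      have "\<bar>x + y\<bar> < int p" using that h by auto
      then have "x + y = 0" using 2 dvd_imp_le_int[of "x + y" "int p"] by fastforce
      then show ?thesis using that by auto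
    qed
  qed
  have "inj_on (\<lambda>x. x\<^sup>2 mod int p) {0..h}"
    by (intro inj_onI *) (auto simp: mod_eq_dvd_iff)
  then have cS: "card S = nat (h + 1)" unfolding S_def by (simp add: card_image)
  have "inj_on (\<lambda>x. (k - x\<^sup>2) mod int p) {0..h}"
  proof (intro inj_onI)
    fix x y assume xy: "x \<in> {0..h}" "y \<in> {0..h}" "(k - x\<^sup>2) mod int p = (k - y\<^sup>2) mod int p"
    then have "int p dvd (k - x\<^sup>2) - (k - y\<^sup>2)" by (simp add: mod_eq_dvd_iff)
    then have "int p dvd y\<^sup>2 - x\<^sup>2" by simp
    then show "x = y" using *[OF xy(2,1)] by simp
  qed
  then have cT: "card T = nat (h + 1)" unfolding T_def by (simp add: card_image)
  have sub: "S \<subseteq> {0..<int p}" "T \<subseteq> {0..<int p}" using p(2) by (auto simp: S_def T_def)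
  have "S \<inter> T \<noteq> {}"
  proof
    assume "S \<inter> T = {}"
    then have "card (S \<union> T) = 2 * nat (h + 1)"
      using cS cT by (subst card_Un_disjoint) (auto simp: S_def T_def)
    moreover have "card (S \<union> T) \<le> card {0..<int p}" using sub by (intro card_mono) auto
    ultimately show False using h h0 by simp
  qed
  then obtain x y where "x\<^sup>2 mod int p = (k - y\<^sup>2) mod int p" by (auto simp: S_def T_def)
  then have "int p dvd x\<^sup>2 - (k - y\<^sup>2)" by (simp add: mod_eq_dvd_iff)
  then have "int p dvd (x\<^sup>2 + y\<^sup>2) - k" by (simp add: algebra_simps)
  then show thesis using that by (simp add: cong_iff_dvd_diff)
qed

text \<open>Multiplication by a point \<open>(u, v)\<close> with \<open>u\<^sup>2 + v\<^sup>2 = k\<close> maps the circle of norm \<open>1\<close> onto that of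
  norm \<open>k\<close>.\<close>

lemma card_circle_eq_card_circle_one:
  fixes p :: nat
  assumes "prime p" "odd p" "\<not> int p dvd k"
  shows "card (circle p k) = card (circle p 1)"
proof -
  obtain u v where uv: "[u\<^sup>2 + v\<^sup>2 = k] (mod int p)"
    using sum_two_squares_mod_prime assms by blast
  have p: "prime (int p)" "int p > 0" using assms prime_gt_0_nat by auto
  have ck: "coprime k (int p)" using p assms(3) by (metis coprime_commute prime_imp_coprime)
  have eq: "u * u - (-v) * v = u\<^sup>2 + v\<^sup>2" by (simp add: power2_eq_square algebra_simps)
  have "coprime (u * u - (-v) * v) (int p)" unfolding eq
    using ck uv by (metis cong_imp_coprime cong_sym)
  then have "card {(x, y) \<in> {0..<int p} \<times> {0..<int p}. [(u * x + (-v) * y)\<^sup>2 + (v * x + u * y)\<^sup>2 = k] (mod p)}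
        = card (circle p k)"
    unfolding circle_def
  proof (intro card_linear_residue_pairs[OF p(2), of _ _ _ _ "\<lambda>x y. [x\<^sup>2 + y\<^sup>2 = k] (mod p)"])
    fix x y x' y' :: int assume "[x = x'] (mod p)" "[y = y'] (mod p)"
    then have "[x\<^sup>2 + y\<^sup>2 = x'\<^sup>2 + y'\<^sup>2] (mod p)" by (intro cong_add cong_pow)
    then show "[x\<^sup>2 + y\<^sup>2 = k] (mod p) \<longleftrightarrow> [x'\<^sup>2 + y'\<^sup>2 = k] (mod p)" by (simp add: cong_def)
  qed
  moreover have "[(u * x + (-v) * y)\<^sup>2 + (v * x + u * y)\<^sup>2 = k] (mod p) \<longleftrightarrow> [x\<^sup>2 + y\<^sup>2 = 1] (mod p)" for x y
  proof -
    have "(u * x + (-v) * y)\<^sup>2 + (v * x + u * y)\<^sup>2 = (u\<^sup>2 + v\<^sup>2) * (x\<^sup>2 + y\<^sup>2)" by (simp add: power2_eq_square algebra_simps)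
    moreover have "[(u\<^sup>2 + v\<^sup>2) * (x\<^sup>2 + y\<^sup>2) = k * (x\<^sup>2 + y\<^sup>2)] (mod p)" by (rule cong_mult[OF uv cong_refl])
    ultimately have "[(u * x + (-v) * y)\<^sup>2 + (v * x + u * y)\<^sup>2 = k] (mod p) \<longleftrightarrow> [k * (x\<^sup>2 + y\<^sup>2) = k * 1] (mod p)"
      by (simp add: cong_def)
    also have "\<dots> \<longleftrightarrow> [x\<^sup>2 + y\<^sup>2 = 1] (mod p)" using ck by (rule cong_mult_lcancel)
    finally show ?thesis .
  qed
  ultimately show ?thesis by (simp add: circle_def)
qed

text \<open>The form is anisotropic: a zero with one coordinate a unit would, after dividing by that
  coordinate, give a square root of -1.\<close>

lemma card_circle_zero_3_mod_4:
  fixes p :: nat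
  assumes "prime p" "odd p" "\<not> [p = 1] (mod 4)"
  shows "card (circle p 0) = 1"
proof -
  have p: "prime (int p)" "p > 2"
    using assms prime_gt_1_nat[of p] by (auto, cases "p = 2", auto)
  have nq: "\<not> QuadRes p (-1)" using QuadRes_minus_one_iff p(2) assms by blast
  have *: "int p dvd y" if h: "int p dvd x\<^sup>2 + y\<^sup>2" for x y
  proof (rule ccontr)
    assume "\<not> int p dvd y"
    then have "coprime y (int p)" using p(1) by (metis coprime_commute prime_imp_coprime)
    then obtain z where z: "[y * z = 1] (mod int p)" using cong_solve_coprime_int by blast
    have "[(x * z)\<^sup>2 + (y * z)\<^sup>2 = 0] (mod int p)"
      using h by (simp add: cong_0_iff power_mult_distrib flip: distrib_right)
    moreover have "[(x * z)\<^sup>2 + (y * z)\<^sup>2 = (x * z)\<^sup>2 + 1\<^sup>2] (mod int p)"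
      by (intro cong_add cong_refl cong_pow z)
    ultimately have "[(x * z)\<^sup>2 + 1 = 0] (mod int p)" by (metis cong_sym cong_trans one_power2)
    then have "[(x * z)\<^sup>2 = -1] (mod int p)" by (simp add: cong_iff_dvd_diff)
    then show False using nq by (auto simp: QuadRes_def)
  qed
  have "x = 0 \<and> y = 0" if "x \<in> {0..<int p}" "y \<in> {0..<int p}" "int p dvd x\<^sup>2 + y\<^sup>2" for x y
    using that *[of x y] *[of y x] by (auto simp: add.commute dest: zdvd_imp_le)
  then have "circle p 0 \<subseteq> {(0, 0)}" unfolding circle_def cong_0_iff by blast
  moreover have "(0, 0) \<in> circle p 0" using p(2) by (simp add: circle_def)
  ultimately have "circle p 0 = {(0, 0)}" by blast
  then show ?thesis by simp
qed

text \<open>The circles are the fibres of the norm form and partition the plane. This total replaces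
  a parametrization of the circle when -1 is not a square.\<close>

lemma sum_card_circle:
  fixes p :: nat
  assumes "p > 0"
  shows "(\<Sum>k\<in>{0..<int p}. card (circle p k)) = p\<^sup>2"
proof -
  have "(\<Union>k\<in>{0..<int p}. circle p k) = {0..<int p} \<times> {0..<int p}"
  proof (intro equalityI subsetI)
    fix u assume "u \<in> {0..<int p} \<times> {0..<int p}"
    then show "u \<in> (\<Union>k\<in>{0..<int p}. circle p k)"
      using assms by (intro UN_I[of "((fst u)\<^sup>2 + (snd u)\<^sup>2) mod int p"]) (auto simp: circle_def cong_def)
  qed (auto simp: circle_def)
  moreover have "card (\<Union>k\<in>{0..<int p}. circle p k) = (\<Sum>k\<in>{0..<int p}. card (circle p k))"
  proof (rule card_UN_disjoint)
    show "\<forall>i\<in>{0..<int p}. \<forall>j\<in>{0..<int p}. i \<noteq> j \<longrightarrow> circle p i \<inter> circle p j = {}"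
      by (auto simp: circle_def cong_def)
  qed auto
  ultimately show ?thesis by (simp add: card_cartesian_product power2_eq_square)
qed

text \<open>The circle of norm 0 is one point and the p - 1 others are equinumerous, so each has
  (p^2 - 1)/(p - 1) points.\<close>

lemma card_circle_3_mod_4:
  fixes p :: nat
  assumes "prime p" "odd p" "\<not> [p = 1] (mod 4)" "\<not> int p dvd k"
  shows "card (circle p k) = p + 1"
proof -
  have p: "p > 1" using assms prime_gt_1_nat by blast
  have "p\<^sup>2 = (\<Sum>k\<in>{0..<int p}. card (circle p k))" using sum_card_circle p by simp
  also have "{0..<int p} = insert 0 {0<..<int p}" using p by auto
  also have "(\<Sum>k\<in>insert 0 {0<..<int p}. card (circle p k)) = 1 + (\<Sum>k\<in>{0<..<int p}. card (circle p k))"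
    using card_circle_zero_3_mod_4[OF assms(1-3)] by simp
  also have "(\<Sum>k\<in>{0<..<int p}. card (circle p k)) = (\<Sum>k\<in>{0<..<int p}. card (circle p 1))"
    by (intro sum.cong refl card_circle_eq_card_circle_one assms) (auto dest: zdvd_imp_le)
  finally have "p\<^sup>2 = 1 + (p - 1) * card (circle p 1)" using p by (simp add: nat_diff_distrib)
  moreover have "p\<^sup>2 = 1 + (p - 1) * (p + 1)" using p by (cases p) (auto simp: power2_eq_square)
  ultimately have "(p - 1) * card (circle p 1) = (p - 1) * (p + 1)" by linarith
  then have "card (circle p 1) = p + 1" using p by (subst (asm) mult_cancel1) simp
  then show ?thesis using card_circle_eq_card_circle_one[OF assms(1,2,4)] by simp
qed

section \<open>The densities \<open>rho\<close> and \<open>beta\<close>\<close>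

lemma hyperbola_cong: "[k = l] (mod p) \<Longrightarrow> hyperbola p k = hyperbola p l"
  by (auto simp: hyperbola_def cong_def)

lemma odd_prime_not_dvd_2:
  fixes p :: nat
  assumes "prime p" "odd p"
  shows "\<not> int p dvd 2"
  using assms by (metis of_nat_dvd_iff of_nat_numeral primes_dvd_imp_eq two_is_prime_nat dvd_refl)

text \<open>The diagonal and the off-diagonal entries are paired because the determinant is the
  difference of the products ad and bc, which makes the fibres over (a, d) hyperbolas.\<close>

lemma bij_betw_SL2_mod_quadruples:
  "bij_betw (\<lambda>g. ((g $ 1 $ 1, g $ 2 $ 2), (g $ 1 $ 2, g $ 2 $ 1))) (SL2_mod q)
     {((a, d), (b, c)) \<in> ({0..<int q} \<times> {0..<int q}) \<times> ({0..<int q} \<times> {0..<int q}).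
        [a * d - b * c = 1] (mod q)}"
proof (rule bij_betwI[where g = "\<lambda>((a, d), (b, c)). vector [vector [a, b], vector [c, d]]"])
  fix g :: "int^2^2"
  show "(\<lambda>((a, d), (b, c)). vector [vector [a, b], vector [c, d]]) ((g $ 1 $ 1, g $ 2 $ 2), (g $ 1 $ 2, g $ 2 $ 1)) = g"
    by (simp add: vec_eq_iff forall_2)
qed (auto simp: SL2_mod_def det_2 forall_2)

lemma finite_SL2_mod [simp]: "finite (SL2_mod q)"
proof -
  have "finite (({0..<int q} \<times> {0..<int q}) \<times> ({0..<int q} \<times> {0..<int q}))" by simp
  then have "finite {((a, d), (b, c)) \<in> ({0..<int q} \<times> {0..<int q}) \<times> ({0..<int q} \<times> {0..<int q}).
        [a * d - b * c = 1] (mod q)}"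
    by (rule rev_finite_subset) auto
  then show ?thesis using bij_betw_finite[OF bij_betw_SL2_mod_quadruples] by blast
qed

text \<open>For fixed (a, d) the pairs (b, c) form the hyperbola bc = ad - 1. It has 2p - 1 points
  for the p - 1 pairs with ad = 1, and p - 1 points for all other pairs.\<close>

lemma card_SL2_mod_prime:
  fixes p :: nat
  assumes "prime p"
  shows "card (SL2_mod p) = p * (p - 1) * (p + 1)"
proof -
  let ?R = "{0..<int p} \<times> {0..<int p}"
  have p: "p > 1" "prime (int p)" using assms prime_gt_1_nat by auto
  have H: "hyperbola p 1 \<subseteq> ?R" by (auto simp: hyperbola_def)
  have "{((a, d), (b, c)) \<in> ?R \<times> ?R. [a * d - b * c = 1] (mod p)} =
      (SIGMA u:?R. hyperbola p (fst u * snd u - 1))"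
    by (auto simp: hyperbola_def cong_iff_dvd_diff dvd_diff_commute algebra_simps)
  then have "card (SL2_mod p) = (\<Sum>u\<in>?R. card (hyperbola p (fst u * snd u - 1)))"
    using bij_betw_same_card[OF bij_betw_SL2_mod_quadruples[of p]] by simp
  also have "\<dots> = (\<Sum>u\<in>?R - hyperbola p 1. card (hyperbola p (fst u * snd u - 1))) +
                  (\<Sum>u\<in>hyperbola p 1. card (hyperbola p (fst u * snd u - 1)))"
    using H by (intro sum.subset_diff) auto
  also have "(\<Sum>u\<in>hyperbola p 1. card (hyperbola p (fst u * snd u - 1))) = (\<Sum>u\<in>hyperbola p 1. 2 * p - 1)"
  proof (intro sum.cong refl)
    fix u assume "u \<in> hyperbola p 1"
    then have "[fst u * snd u - 1 = 0] (mod p)" by (auto simp: hyperbola_def cong_iff_dvd_diff)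
    then show "card (hyperbola p (fst u * snd u - 1)) = 2 * p - 1"
      using card_hyperbola_zero[OF assms] hyperbola_cong by metis
  qed
  also have "(\<Sum>u\<in>?R - hyperbola p 1. card (hyperbola p (fst u * snd u - 1))) = (\<Sum>u\<in>?R - hyperbola p 1. p - 1)"
  proof (intro sum.cong refl)
    fix u assume "u \<in> ?R - hyperbola p 1"
    then have "\<not> int p dvd fst u * snd u - 1" by (auto simp: hyperbola_def cong_iff_dvd_diff)
    then show "card (hyperbola p (fst u * snd u - 1)) = p - 1" by (rule card_hyperbola_nonzero[OF assms])
  qed
  also have "(\<Sum>u\<in>?R - hyperbola p 1. p - 1) = (p * p - (p - 1)) * (p - 1)"
    using H p card_hyperbola_nonzero[OF assms, of 1] by (simp add: card_Diff_subset card_cartesian_product)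
  also have "(\<Sum>u\<in>hyperbola p 1. 2 * p - 1) = (p - 1) * (2 * p - 1)"
    using p card_hyperbola_nonzero[OF assms, of 1] by simp
  also have "(p * p - (p - 1)) * (p - 1) + (p - 1) * (2 * p - 1) = p * (p - 1) * (p + 1)"
  proof -
    obtain k where "p = Suc k" using p by (cases p) auto
    then show ?thesis by (simp add: algebra_simps)
  qed
  finally show ?thesis .
qed

text \<open>In the coordinates \<open>(a, d) = (x + u, x - u)\<close>, \<open>(b, c) = (y + v, v - y)\<close> the determinant is
  \<open>S - T\<close> and \<open>ff\<close> is \<open>2 (S + T)\<close>, where \<open>S = x\<^sup>2 + y\<^sup>2\<close> and \<open>T = u\<^sup>2 + v\<^sup>2\<close>.\<close>

lemma det_ff_sum_diff_coordinates:
  fixes p :: nat and x y u v :: int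
  assumes "prime p" "odd p"
  shows "[(x + u) * (x - u) - (y + v) * (v - y) = 1] (mod p) \<and>
         [(x + u)\<^sup>2 + (y + v)\<^sup>2 + (v - y)\<^sup>2 + (x - u)\<^sup>2 = 2] (mod p) \<longleftrightarrow>
         [x\<^sup>2 + y\<^sup>2 = 1] (mod p) \<and> [u\<^sup>2 + v\<^sup>2 = 0] (mod p)" (is ?A)
    and "[(x + u) * (x - u) - (y + v) * (v - y) = 1] (mod p) \<and>
         [(x + u)\<^sup>2 + (y + v)\<^sup>2 + (v - y)\<^sup>2 + (x - u)\<^sup>2 = -2] (mod p) \<longleftrightarrow>
         [x\<^sup>2 + y\<^sup>2 = 0] (mod p) \<and> [u\<^sup>2 + v\<^sup>2 = -1] (mod p)" (is ?B)
proof -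
  define S T where "S = x\<^sup>2 + y\<^sup>2" and "T = u\<^sup>2 + v\<^sup>2"
  have 1: "(x + u) * (x - u) - (y + v) * (v - y) = S - T"
    and 2: "(x + u)\<^sup>2 + (y + v)\<^sup>2 + (v - y)\<^sup>2 + (x - u)\<^sup>2 = 2 * (S + T)"
    by (simp_all add: S_def T_def power2_eq_square algebra_simps)
  have p: "prime (int p)" "\<not> int p dvd 2"
    using assms prime_gt_1_nat[of p] odd_prime_not_dvd_2 by auto
  have two: "int p dvd 2 * z \<longleftrightarrow> int p dvd z" for z
    using p prime_dvd_mult_iff[OF p(1)] by blast
  \<comment> \<open>The values e = 1 and e = -1 stand for \<open>ff\<close> equal to 2 and -2.
    Adding and subtracting the two congruences isolates \<open>2 * S\<close> and
    \<open>2 * T\<close>, and 2 is a unit modulo p.\<close>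
  have gen: "int p dvd S - T - 1 \<and> int p dvd 2 * (S + T) - 2 * e \<longleftrightarrow>
       int p dvd 2 * S - (1 + e) \<and> int p dvd 2 * T - (e - 1)" for e
  proof -
    have e: "int p dvd 2 * (S + T) - 2 * e \<longleftrightarrow> int p dvd S + T - e"
      using two[of "S + T - e"] by (simp add: algebra_simps)
    show ?thesis unfolding e
    proof safe
      assume h: "int p dvd S - T - 1" "int p dvd S + T - e"
      show "int p dvd 2 * S - (1 + e)" using dvd_add[OF h] by (simp add: algebra_simps)
      show "int p dvd 2 * T - (e - 1)" using dvd_diff[OF h(2,1)] by (simp add: algebra_simps)
    next
      assume h: "int p dvd 2 * S - (1 + e)" "int p dvd 2 * T - (e - 1)"
      have "int p dvd 2 * (S - T - 1)" using dvd_diff[OF h] by (simp add: algebra_simps)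
      then show "int p dvd S - T - 1" unfolding two .
      have "int p dvd 2 * (S + T - e)" using dvd_add[OF h] by (simp add: algebra_simps)
      then show "int p dvd S + T - e" unfolding two .
    qed
  qed
  have s: "int p dvd 2 * S - 2 \<longleftrightarrow> int p dvd S - 1" "int p dvd 2 * T + 2 \<longleftrightarrow> int p dvd T + 1"
    using two[of "S - 1"] two[of "T + 1"] by (simp_all add: algebra_simps)
  show ?A unfolding 1 2 cong_iff_dvd_diff S_def[symmetric] T_def[symmetric]
    using gen[of 1] s two by simp
  show ?B unfolding 1 2 cong_iff_dvd_diff S_def[symmetric] T_def[symmetric]
    using gen[of "-1"] s two by simp
qed

text \<open>In sum and difference coordinates the conditions decouple into norms 1 and 0 for e = 1,
  and 0 and -1 for e = -1. Either way a circle of norm 0 meets one of norm e in a product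
  set.\<close>

lemma card_SL2_mod_ff:
  fixes p :: nat and e :: int
  assumes "prime p" "odd p" and e: "e = 1 \<or> e = -1"
  shows "card {g\<in>SL2_mod p. [ff g = 2 * e] (mod p)} = card (circle p 0) * card (circle p e)"
proof -
  let ?R = "{0..<int p} \<times> {0..<int p}"
  define Q where "Q = (\<lambda>((a::int, d::int), (b::int, c::int)). [a * d - b * c = 1] (mod p) \<and>
    [a\<^sup>2 + b\<^sup>2 + c\<^sup>2 + d\<^sup>2 = 2 * e] (mod p))"
  \<comment> \<open>The maps \<open>f1\<close> and \<open>f2\<close> have determinants -2 and 2,
    which are units because p is odd.\<close>
  define f1 where "f1 = (\<lambda>(x, u). ((1 * x + 1 * u) mod int p, (1 * x + -1 * u) mod int p))"
  define f2 where "f2 = (\<lambda>(y, v). ((1 * y + 1 * v) mod int p, (-1 * y + 1 * v) mod int p))"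
  have p: "prime (int p)" "\<not> int p dvd 2" "int p > 0"
    using assms prime_gt_1_nat[of p] odd_prime_not_dvd_2 by auto
  then have cop: "coprime 2 (int p)" by (metis coprime_commute prime_imp_coprime)
  have "bij_betw f1 ?R ?R" unfolding f1_def
    by (rule bij_betw_linear_residue_pairs) (use p cop in simp_all)
  moreover have "bij_betw f2 ?R ?R" unfolding f2_def
    by (rule bij_betw_linear_residue_pairs) (use p cop in simp_all)
  ultimately have bij: "bij_betw (map_prod f1 f2) (?R \<times> ?R) (?R \<times> ?R)"
    by (rule bij_betw_map_prod)
  have Qcong: "Q ((a mod int p, d mod int p), (b mod int p, c mod int p)) \<longleftrightarrow> Q ((a, d), (b, c))" for a b c d
  proof -
    have m: "[z mod int p = z] (mod p)" for z by (simp add: cong_def)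
    have 1: "[(a mod int p) * (d mod int p) - (b mod int p) * (c mod int p) = a * d - b * c] (mod p)"
      by (rule cong_diff[OF cong_mult[OF m m] cong_mult[OF m m]])
    have 2: "[(a mod int p)\<^sup>2 + (b mod int p)\<^sup>2 + (c mod int p)\<^sup>2 + (d mod int p)\<^sup>2 = a\<^sup>2 + b\<^sup>2 + c\<^sup>2 + d\<^sup>2] (mod p)"
      by (rule cong_add[OF cong_add[OF cong_add[OF cong_pow[OF m] cong_pow[OF m]] cong_pow[OF m]] cong_pow[OF m]])
    have "[x = z] (mod p) \<longleftrightarrow> [y = z] (mod p)" if "[x = y] (mod p)" for x y z :: int
      using that by (metis cong_sym cong_trans)
    then show ?thesis unfolding Q_def prod.case using 1 2 by blast
  qed
  have "{g\<in>SL2_mod p. [ff g = 2 * e] (mod p)} =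
      {g\<in>SL2_mod p. Q ((g $ 1 $ 1, g $ 2 $ 2), (g $ 1 $ 2, g $ 2 $ 1))}"
    by (auto simp: Q_def ff_def SL2_mod_def det_2)
  then have "card {g\<in>SL2_mod p. [ff g = 2 * e] (mod p)} =
      card {w \<in> {((a, d), (b, c)) \<in> ?R \<times> ?R. [a * d - b * c = 1] (mod p)}. Q w}"
    using card_Collect_bij_betw[OF bij_betw_SL2_mod_quadruples[of p], of Q] by simp
  also have "{w \<in> {((a, d), (b, c)) \<in> ?R \<times> ?R. [a * d - b * c = 1] (mod p)}. Q w} = {w \<in> ?R \<times> ?R. Q w}"
    by (auto simp: Q_def)
  also have "card \<dots> = card {w \<in> ?R \<times> ?R. Q (map_prod f1 f2 w)}"
    using card_Collect_bij_betw[OF bij, of Q] by simp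
  \<comment> \<open>The coordinate change couples x with u and y with v, whereas the circles live in
    (x, y) and (u, v), so the four coordinates are regrouped.\<close>
  also have "\<dots> = card {((x, y), (u, v)) \<in> ?R \<times> ?R. Q ((x + u, x - u), (y + v, v - y))}"
  proof (rule bij_betw_same_card[of "\<lambda>((x, u), (y, v)). ((x, y), (u, v))"],
      rule bij_betwI[where g = "\<lambda>((x, y), (u, v)). ((x, u), (y, v))"])
    show "(\<lambda>((x, u), y, v). ((x, y), u, v))
      \<in> {w \<in> ?R \<times> ?R. Q (map_prod f1 f2 w)} \<rightarrow> {((x, y), (u, v)) \<in> ?R \<times> ?R. Q ((x + u, x - u), (y + v, v - y))}"
      using Qcong by (fastforce simp: f1_def f2_def)
    show "(\<lambda>((x, y), u, v). ((x, u), y, v))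
      \<in> {((x, y), (u, v)) \<in> ?R \<times> ?R. Q ((x + u, x - u), (y + v, v - y))} \<rightarrow> {w \<in> ?R \<times> ?R. Q (map_prod f1 f2 w)}"
      using Qcong by (fastforce simp: f1_def f2_def)
  qed auto
  also have "\<dots> = card (circle p 0) * card (circle p e)"
    using e
  proof
    assume "e = 1"
    then have "{((x, y), (u, v)) \<in> ?R \<times> ?R. Q ((x + u, x - u), (y + v, v - y))} = circle p 1 \<times> circle p 0"
      using det_ff_sum_diff_coordinates(1)[OF assms(1,2)] unfolding Q_def circle_def by auto
    then show ?thesis using \<open>e = 1\<close> by (simp add: card_cartesian_product)
  next
    assume "e = -1"
    then have "{((x, y), (u, v)) \<in> ?R \<times> ?R. Q ((x + u, x - u), (y + v, v - y))} = circle p 0 \<times> circle p (-1)"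
      using det_ff_sum_diff_coordinates(2)[OF assms(1,2)] unfolding Q_def circle_def by auto
    then show ?thesis using \<open>e = -1\<close> by (simp add: card_cartesian_product)
  qed
  finally show ?thesis .
qed

text \<open>Halving is impossible modulo 2, so the two solutions are found by enumeration: the
  identity and the swap matrix.\<close>

lemma card_SL2_mod_2_ff:
  "card {g\<in>SL2_mod 2. [ff g = 2] (mod 2)} = 2"
proof -
  let ?Q = "\<lambda>((a, d), (b, c)). [a\<^sup>2 + b\<^sup>2 + c\<^sup>2 + d\<^sup>2 = 2] (mod (2::int))"
  have "{g\<in>SL2_mod 2. [ff g = 2] (mod 2)} =
      {g\<in>SL2_mod 2. ?Q ((g $ 1 $ 1, g $ 2 $ 2), (g $ 1 $ 2, g $ 2 $ 1))}"
    by (simp add: ff_def)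
  then have "card {g\<in>SL2_mod 2. [ff g = 2] (mod 2)} =
      card {w \<in> {((a, d), (b, c)) \<in> ({0..<int 2} \<times> {0..<int 2}) \<times> ({0..<int 2} \<times> {0..<int 2}).
        [a * d - b * c = 1] (mod int 2)}. ?Q w}"
    using card_Collect_bij_betw[OF bij_betw_SL2_mod_quadruples[of 2], of ?Q] by simp
  also have "{w \<in> {((a, d), (b, c)) \<in> ({0..<int 2} \<times> {0..<int 2}) \<times> ({0..<int 2} \<times> {0..<int 2}).
        [a * d - b * c = 1] (mod int 2)}. ?Q w} = {((1, 1), (0, 0)), ((0, 0), (1, 1))}" (is "?L = ?E")
  proof (intro equalityI subsetI)
    fix w assume w: "w \<in> ?L"
    obtain a b c d where eq: "w = ((a, d), (b, c))" by (metis prod.collapse)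
    have "a = 0 \<or> a = 1" "b = 0 \<or> b = 1" "c = 0 \<or> c = 1" "d = 0 \<or> d = 1"
        and "[a * d - b * c = 1] (mod 2)" "[a\<^sup>2 + b\<^sup>2 + c\<^sup>2 + d\<^sup>2 = 2] (mod 2)"
      using w unfolding eq by auto
    then show "w \<in> ?E" unfolding eq by (elim disjE) (simp_all add: cong_def)
  next
    fix w assume "w \<in> ?E"
    then consider "w = ((1, 1), (0, 0))" | "w = ((0, 0), (1, 1))" by blast
    then show "w \<in> ?L" by cases (simp_all add: cong_def)
  qed
  finally show ?thesis by simp
qed

lemma square_cong_4_mod_prime:
  fixes p :: nat and \<tau> :: int
  assumes "prime p"
  shows "[\<tau>\<^sup>2 = 4] (mod p) \<longleftrightarrow> [\<tau> = 2] (mod p) \<or> [\<tau> = -2] (mod p)"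
proof -
  have "\<tau>\<^sup>2 - 4 = (\<tau> - 2) * (\<tau> + 2)" by (simp add: power2_eq_square algebra_simps)
  then show ?thesis using assms by (simp add: cong_iff_dvd_diff prime_dvd_mult_iff)
qed

text \<open>The number of solutions of \<open>ff g = 2\<close> (equivalently \<open>ff g = -2\<close>) in \<open>SL\<^sub>2(\<int>/p)\<close>.\<close>

definition num_ff :: "nat \<Rightarrow> nat" where
  "num_ff p = (if p = 2 then 2 else if [p = 1] (mod 4) then (2 * p - 1) * (p - 1) else p + 1)"

text \<open>Modulo a prime a root of 4 is 2 or -2. For p = 2 these coincide; for odd p the count
  involves only a circle of norm 1 or -1, whose size does not depend on the sign.\<close>

lemma card_ff_eq_root:
  fixes p :: nat and \<tau> :: int
  assumes "prime p" "[\<tau>\<^sup>2 = 4] (mod p)"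
  shows "card {g\<in>SL2_mod p. [ff g = \<tau>] (mod p)} = num_ff p"
proof (cases "p = 2")
  case True
  then have "[\<tau> = 2] (mod p)"
    using assms square_cong_4_mod_prime[of p \<tau>] by (auto simp: cong_iff_dvd_diff)
  then have "{g\<in>SL2_mod p. [ff g = \<tau>] (mod p)} = {g\<in>SL2_mod 2. [ff g = 2] (mod 2)}"
    using True by (auto simp: cong_def)
  then show ?thesis using card_SL2_mod_2_ff True by (simp add: num_ff_def)
next
  case False
  then have odd: "odd p" using assms(1) primes_dvd_imp_eq two_is_prime_nat by blast
  obtain e :: int where e: "e = 1 \<or> e = -1" and "[\<tau> = 2 * e] (mod p)"
    using assms square_cong_4_mod_prime[of p \<tau>] by (metis mult.right_neutral mult_minus_right)
  then have "{g\<in>SL2_mod p. [ff g = \<tau>] (mod p)} = {g\<in>SL2_mod p. [ff g = 2 * e] (mod p)}"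
    by (auto simp: cong_def)
  then have *: "card {g\<in>SL2_mod p. [ff g = \<tau>] (mod p)} = card (circle p 0) * card (circle p e)"
    using card_SL2_mod_ff[OF assms(1) odd e] by simp
  have ne: "\<not> int p dvd e" using e assms(1) by auto
  show ?thesis
  proof (cases "[p = 1] (mod 4)")
    case True
    then show ?thesis
      using * False card_circle_1_mod_4[OF assms(1) True] card_hyperbola_zero[OF assms(1)]
        card_hyperbola_nonzero[OF assms(1) ne] by (simp add: num_ff_def)
  next
    case nt: False
    then show ?thesis
      using * False card_circle_zero_3_mod_4[OF assms(1) odd nt] card_circle_3_mod_4[OF assms(1) odd nt ne]
      by (simp add: num_ff_def)
  qed
qed

lemma rho_prime_eq:
  assumes "prime p"
  shows "rho_prime p = real (num_ff p) / real (card (SL2_mod p))"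
  unfolding rho_prime_def using card_ff_eq_root[OF assms, of 2] by simp

lemma rho_prime_explicit:
  assumes "prime p"
  shows "rho_prime p =
    (if p = 2 then 1 / 3
     else if [p = 1] (mod 4) then (2 * real p - 1) / (real p * (real p + 1))
     else 1 / (real p * (real p - 1)))"
proof -
  have p: "p > 1" using assms prime_gt_1_nat by blast
  have c: "real (card (SL2_mod p)) = real p * (real p - 1) * (real p + 1)"
    unfolding card_SL2_mod_prime[OF assms] of_nat_mult using p by (simp add: of_nat_diff)
  have pm: "real p - 1 \<noteq> 0" "real p + 1 \<noteq> 0" using p by simp_all
  have r: "real ((2 * p - 1) * (p - 1)) = (2 * real p - 1) * (real p - 1)" using p by (simp add: of_nat_diff)
  consider "p = 2" | "p \<noteq> 2" "[p = 1] (mod 4)" | "p \<noteq> 2" "\<not> [p = 1] (mod 4)" by blast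
  then show ?thesis
  proof cases
    case 1
    have "rho_prime p = real (num_ff p) / (real p * (real p - 1) * (real p + 1))"
      using rho_prime_eq[OF assms] c by metis
    then show ?thesis using 1 by (simp add: num_ff_def)
  next
    case 2
    then have "num_ff p = (2 * p - 1) * (p - 1)" by (simp add: num_ff_def)
    then have "rho_prime p = (2 * real p - 1) * (real p - 1) / (real p * (real p - 1) * (real p + 1))"
      unfolding rho_prime_eq[OF assms] c r[symmetric] by simp
    then show ?thesis using 2 pm by simp
  next
    case 3
    then have "num_ff p = p + 1" by (simp add: num_ff_def)
    then have "rho_prime p = (real p + 1) / (real p * (real p - 1) * (real p + 1))"
      unfolding rho_prime_eq[OF assms] c by (simp add: add.commute)
    then show ?thesis using 3 pm by simp
  qed
qed

lemma rho_prime_bounds: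
  assumes "prime p"
  shows "0 \<le> rho_prime p" "rho_prime p \<le> 2 / real p"
proof -
  have p: "real p \<ge> 2" using assms prime_ge_2_nat by (metis of_nat_le_iff of_nat_numeral)
  show "0 \<le> rho_prime p" by (simp add: rho_prime_def)
  have "(2 * real p - 1) / (real p * (real p + 1)) \<le> 2 / real p"
    "1 / (real p * (real p - 1)) \<le> 2 / real p"
    using p by (simp_all add: divide_simps)
  moreover have "1 / 3 \<le> 2 / real p" if "p = 2" using that by simp
  ultimately show "rho_prime p \<le> 2 / real p"
    unfolding rho_prime_explicit[OF assms] by presburger
qed

lemma num_ff_le:
  assumes "prime p"
  shows "num_ff p \<le> 2 * p\<^sup>2"
proof -
  have p: "p \<ge> 2" using assms prime_ge_2_nat by blast
  have "(2 * p - 1) * (p - 1) \<le> (2 * p) * p" by (intro mult_mono) auto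
  moreover have "2 * p * 1 \<le> 2 * p * p" using p by (intro mult_left_mono) auto
  moreover have "p + 1 \<le> 2 * p * 1" using p by simp
  ultimately have "(2 * p - 1) * (p - 1) \<le> 2 * p\<^sup>2" "p + 1 \<le> 2 * p\<^sup>2" "2 \<le> 2 * p\<^sup>2"
    using p by (simp_all only: power2_eq_square mult.assoc)
  then show ?thesis unfolding num_ff_def by presburger
qed

text \<open>The index set of \<open>\<tau>\<close> in \<open>main_M\<close>, named so that its size
  can be treated as a multiplicative function.\<close>

definition roots4 :: "nat \<Rightarrow> int set" where
  "roots4 q = {\<tau>. 0 \<le> \<tau> \<and> \<tau> < int q \<and> [\<tau>\<^sup>2 = 4] (mod int q)}"

lemma finite_roots4 [simp]: "finite (roots4 q)"
  by (rule finite_subset[of _ "{0..<int q}"]) (auto simp: roots4_def)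

lemma card_roots4_prime:
  assumes "prime p"
  shows "card (roots4 p) = (if p = 2 then 1 else 2)"
proof -
  have p: "p > 1" using assms prime_gt_1_nat by blast
  have "roots4 p = {2 mod int p, (-2) mod int p}"
  proof (intro equalityI subsetI)
    fix \<tau> assume "\<tau> \<in> roots4 p"
    then show "\<tau> \<in> {2 mod int p, (-2) mod int p}"
      using square_cong_4_mod_prime[OF assms, of \<tau>] by (auto simp: roots4_def cong_def)
  next
    fix \<tau> assume t: "\<tau> \<in> {2 mod int p, (-2) mod int p}"
    then have "[\<tau> = 2] (mod p) \<or> [\<tau> = -2] (mod p)" by (auto simp: cong_def)
    then show "\<tau> \<in> roots4 p"
      using t p square_cong_4_mod_prime[OF assms, of \<tau>] by (auto simp: roots4_def)
  qed
  moreover have "2 mod int p = (-2) mod int p \<longleftrightarrow> p = 2"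
  proof -
    have "2 mod int p = (-2) mod int p \<longleftrightarrow> int p dvd 2 * 2" by (simp add: mod_eq_dvd_iff)
    also have "\<dots> \<longleftrightarrow> int p dvd 2" using assms by (subst prime_dvd_mult_iff) auto
    also have "\<dots> \<longleftrightarrow> p = 2" using p by (auto dest: zdvd_imp_le)
    finally show ?thesis .
  qed
  ultimately show ?thesis by simp
qed

text \<open>The roots 2 and -2 differ exactly for odd primes. Hence the factor 2 in
  \<open>beta_prime\<close> at odd p and its absence at p = 2.\<close>

lemma beta_prime_eq:
  assumes "prime p"
  shows "beta_prime p = real (card (roots4 p)) * rho_prime p"
  unfolding beta_prime_def rho_prime_explicit[OF assms] card_roots4_prime[OF assms] by simp

section \<open>Averages of \<open>Xi\<close> over \<open>SL\<^sub>2(\<int>/d)\<close>\<close>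

definition mat_mod :: "nat \<Rightarrow> int^2^2 \<Rightarrow> int^2^2" where
  "mat_mod q g = (\<chi> i j. g $ i $ j mod int q)"

lemma mat_cong_iff_mat_mod_eq: "mat_cong q g h \<longleftrightarrow> mat_mod q g = mat_mod q h"
  by (simp add: mat_cong_def mat_mod_def vec_eq_iff cong_def)

lemma mat_cong_refl [simp]: "mat_cong q g g"
  by (simp add: mat_cong_iff_mat_mod_eq)

lemma mat_cong_trans: "mat_cong q g h \<Longrightarrow> mat_cong q h k \<Longrightarrow> mat_cong q g k"
  by (auto simp: mat_cong_iff_mat_mod_eq)

lemma mat_cong_mat_mod: "mat_cong q (mat_mod q g) g"
  by (simp add: mat_cong_def mat_mod_def cong_def)

lemma mat_cong_dvd: "mat_cong q g h \<Longrightarrow> r dvd q \<Longrightarrow> mat_cong r g h"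
  unfolding mat_cong_def by (meson cong_dvd_modulus of_nat_dvd_iff)

lemma mat_cong_det: "mat_cong q g h \<Longrightarrow> [det g = det h] (mod q)"
  unfolding mat_cong_def det_2 by (rule cong_diff[OF cong_mult cong_mult]) blast+

lemma mat_cong_ff: "mat_cong q g h \<Longrightarrow> [ff g = ff h] (mod q)"
  unfolding mat_cong_def ff_def
  by (rule cong_add[OF cong_add[OF cong_add[OF cong_pow cong_pow] cong_pow] cong_pow]) blast+

lemma mat_cong_mult:
  assumes "mat_cong q g h" "mat_cong q g' h'"
  shows "mat_cong q (g ** g') (h ** h')"
  unfolding mat_cong_def
proof (intro allI)
  fix i j
  have *: "[g $ i $ k = h $ i $ k] (mod q)" "[g' $ k $ j = h' $ k $ j] (mod q)" for k
    using assms by (auto simp: mat_cong_def)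
  have "[g $ i $ 1 * g' $ 1 $ j + g $ i $ 2 * g' $ 2 $ j = h $ i $ 1 * h' $ 1 $ j + h $ i $ 2 * h' $ 2 $ j] (mod q)"
    by (intro cong_add cong_mult *)
  then show "[(g ** g') $ i $ j = (h ** h') $ i $ j] (mod q)"
    by (simp add: matrix_matrix_mult_def sum_2)
qed

lemma mat_mod_in_SL2_mod:
  assumes "q > 0" "[det g = 1] (mod q)"
  shows "mat_mod q g \<in> SL2_mod q"
  using assms mat_cong_det[OF mat_cong_mat_mod[of q g]]
  by (auto simp: SL2_mod_def mat_mod_def cong_def)

lemma mat_mod_SL2_mod: "g \<in> SL2_mod q \<Longrightarrow> mat_mod q g = g"
  by (simp add: SL2_mod_def mat_mod_def vec_eq_iff)

text \<open>The Chinese remainder theorem is applied to each entry; the determinant of the lift is 1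
  modulo m and modulo n, hence modulo the product.\<close>

lemma bij_betw_SL2_mod_chinese_remainder:
  assumes "m > 0" "n > 0" "coprime m n"
  shows "bij_betw (\<lambda>g. (mat_mod m g, mat_mod n g)) (SL2_mod (m * n)) (SL2_mod m \<times> SL2_mod n)"
  unfolding bij_betw_def
proof (intro conjI inj_onI)
  have cop: "coprime (int m) (int n)" using assms by simp
  fix g h assume gh: "g \<in> SL2_mod (m * n)" "h \<in> SL2_mod (m * n)"
    and "(mat_mod m g, mat_mod n g) = (mat_mod m h, mat_mod n h)"
  then have "mat_cong m g h" "mat_cong n g h" by (auto simp: mat_cong_iff_mat_mod_eq)
  then have "mat_cong (m * n) g h"
    using cop by (auto simp: mat_cong_def intro: coprime_cong_mult)
  then show "g = h" using gh by (metis mat_cong_iff_mat_mod_eq mat_mod_SL2_mod)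
next
  have cop: "coprime (int m) (int n)" using assms by simp
  show "(\<lambda>g. (mat_mod m g, mat_mod n g)) ` SL2_mod (m * n) = SL2_mod m \<times> SL2_mod n"
  proof (intro equalityI subsetI)
    fix w assume "w \<in> (\<lambda>g. (mat_mod m g, mat_mod n g)) ` SL2_mod (m * n)"
    then obtain g where g: "g \<in> SL2_mod (m * n)" "w = (mat_mod m g, mat_mod n g)" by blast
    then have "[det g = 1] (mod int m * int n)" by (simp add: SL2_mod_def)
    then have "[det g = 1] (mod m)" "[det g = 1] (mod n)"
      by (auto intro: cong_dvd_modulus)
    then show "w \<in> SL2_mod m \<times> SL2_mod n" using g assms mat_mod_in_SL2_mod by auto
  next
    fix w assume "w \<in> SL2_mod m \<times> SL2_mod n"
    then obtain g h where gh: "w = (g, h)" "g \<in> SL2_mod m" "h \<in> SL2_mod n" by auto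
    have "\<forall>i j. \<exists>x. [x = g $ i $ j] (mod m) \<and> [x = h $ i $ j] (mod n)"
      using binary_chinese_remainder_int[OF cop] by blast
    then obtain x where x: "[x i j = g $ i $ j] (mod m)" "[x i j = h $ i $ j] (mod n)" for i j
      by metis
    define k :: "int^2^2" where "k = (\<chi> i j. x i j)"
    have k: "mat_cong m k g" "mat_cong n k h" using x by (auto simp: k_def mat_cong_def)
    have "[det k = 1] (mod m)" "[det k = 1] (mod n)"
      using mat_cong_det[OF k(1)] mat_cong_det[OF k(2)] gh by (auto simp: SL2_mod_def intro: cong_trans)
    then have "[det k = 1] (mod int (m * n))" using cop by (auto intro: coprime_cong_mult)
    then have "mat_mod (m * n) k \<in> SL2_mod (m * n)" using assms mat_mod_in_SL2_mod by auto
    moreover have "mat_mod m (mat_mod (m * n) k) = g"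
    proof -
      have "mat_cong m (mat_mod (m * n) k) g"
        using mat_cong_dvd[OF mat_cong_mat_mod[of "m * n" k], of m] k mat_cong_trans by auto
      then show ?thesis using gh by (metis mat_cong_iff_mat_mod_eq mat_mod_SL2_mod)
    qed
    moreover have "mat_mod n (mat_mod (m * n) k) = h"
    proof -
      have "mat_cong n (mat_mod (m * n) k) h"
        using mat_cong_dvd[OF mat_cong_mat_mod[of "m * n" k], of n] k mat_cong_trans by auto
      then show ?thesis using gh by (metis mat_cong_iff_mat_mod_eq mat_mod_SL2_mod)
    qed
    ultimately show "w \<in> (\<lambda>g. (mat_mod m g, mat_mod n g)) ` SL2_mod (m * n)"
      using gh(1) by (metis (mono_tags, lifting) rev_image_eqI)
  qed
qed

text \<open>The tool that reduces both the sum of \<open>Xi\<close> and the sum of its absolute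
  values to prime moduli.\<close>

lemma sum_SL2_mod_mult:
  fixes F G :: "int^2^2 \<Rightarrow> real"
  assumes "m > 0" "n > 0" "coprime m n"
    and F: "\<And>g h. mat_cong m g h \<Longrightarrow> F g = F h"
    and G: "\<And>g h. mat_cong n g h \<Longrightarrow> G g = G h"
  shows "(\<Sum>g\<in>SL2_mod (m * n). F g * G g) = (\<Sum>g\<in>SL2_mod m. F g) * (\<Sum>g\<in>SL2_mod n. G g)"
proof -
  have "(\<Sum>g\<in>SL2_mod m. F g) * (\<Sum>g\<in>SL2_mod n. G g) = (\<Sum>(g, h)\<in>SL2_mod m \<times> SL2_mod n. F g * G h)"
    by (simp add: sum_product sum.cartesian_product)
  also have "\<dots> = (\<Sum>g\<in>SL2_mod (m * n). case (mat_mod m g, mat_mod n g) of (g, h) \<Rightarrow> F g * G h)"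
    by (rule sum.reindex_bij_betw[symmetric, OF bij_betw_SL2_mod_chinese_remainder[OF assms(1-3)]])
  also have "\<dots> = (\<Sum>g\<in>SL2_mod (m * n). F g * G g)"
    using F[OF mat_cong_mat_mod] G[OF mat_cong_mat_mod] by simp
  finally show ?thesis by simp
qed

lemma prime_factors_mult_coprime:
  fixes m n :: nat
  assumes "m > 0" "n > 0" "coprime m n"
  shows "prime_factors (m * n) = prime_factors m \<union> prime_factors n" "prime_factors m \<inter> prime_factors n = {}"
proof -
  show "prime_factors (m * n) = prime_factors m \<union> prime_factors n"
    using assms by (intro prime_factors_product) auto
  show "prime_factors m \<inter> prime_factors n = {}"
  proof (rule ccontr)
    assume "prime_factors m \<inter> prime_factors n \<noteq> {}"
    then obtain p where "prime p" "p dvd m" "p dvd n" by auto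
    then show False using assms(3) coprime_common_divisor not_prime_unit by blast
  qed
qed

lemma Xi_mult:
  assumes "m > 0" "n > 0" "coprime m n"
  shows "Xi (m * n) k = Xi m k * Xi n k"
  unfolding Xi_def prime_factors_mult_coprime(1)[OF assms]
  by (rule prod.union_disjoint) (use prime_factors_mult_coprime(2)[OF assms] in auto)

lemma Xi_cong:
  assumes "[k = l] (mod int q)"
  shows "Xi q k = Xi q l"
  unfolding Xi_def
proof (intro prod.cong refl)
  fix p assume "p \<in> prime_factors q"
  then have "[k = l] (mod int p)" using assms by (auto simp: in_prime_factors_iff intro: cong_dvd_modulus)
  then show "of_bool [k = 0] (mod int p) - rho_prime p = of_bool [l = 0] (mod int p) - rho_prime p"
    by (simp add: cong_def)
qed

lemma Xi_ff_mat_cong: "mat_cong q g h \<Longrightarrow> Xi q (ff g - \<tau>) = Xi q (ff h - \<tau>)"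
  by (rule Xi_cong[OF cong_diff[OF mat_cong_ff cong_refl]])

lemma Xi_prime:
  assumes "prime p"
  shows "Xi p k = of_bool [k = 0] (mod int p) - rho_prime p"
  using assms by (simp add: Xi_def prime_prime_factors)

lemma sum_of_bool_ff:
  assumes "prime p" "[\<tau>\<^sup>2 = 4] (mod int p)"
  shows "(\<Sum>g\<in>SL2_mod p. of_bool [ff g - \<tau> = 0] (mod int p)) = real (card (SL2_mod p)) * rho_prime p"
proof -
  have "{g \<in> SL2_mod p. [ff g - \<tau> = 0] (mod int p)} = {g \<in> SL2_mod p. [ff g = \<tau>] (mod int p)}"
    by (auto simp: cong_iff_dvd_diff)
  then have "(\<Sum>g\<in>SL2_mod p. of_bool [ff g - \<tau> = 0] (mod int p)) = real (num_ff p)"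
    using card_ff_eq_root[OF assms] by (simp add: Int_def)
  moreover have "card (SL2_mod p) > 0"
    using card_SL2_mod_prime[OF assms(1)] prime_gt_1_nat[OF assms(1)] by simp
  ultimately show ?thesis by (auto simp: rho_prime_eq[OF assms(1)])
qed

text \<open>\<open>rho_prime\<close> is the mean of the indicator at the root 2, and that mean is
  the same at every root of 4.\<close>

lemma sum_Xi_prime_eq_0:
  assumes "prime p" "[\<tau>\<^sup>2 = 4] (mod int p)"
  shows "(\<Sum>g\<in>SL2_mod p. Xi p (ff g - \<tau>)) = 0"
  by (simp add: Xi_prime[OF assms(1)] sum_subtractf sum_of_bool_ff[OF assms])

text \<open>By the triangle inequality the indicator and the constant \<open>rho_prime\<close> each
  contribute \<open>num_ff p\<close>, which is at most 2p^2. Bounding \<open>Xi\<close> pointwise by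
  a constant would cost the full order of the group, about p^3.\<close>

lemma sum_abs_Xi_prime_le:
  assumes "prime p" "[\<tau>\<^sup>2 = 4] (mod int p)"
  shows "(\<Sum>g\<in>SL2_mod p. \<bar>Xi p (ff g - \<tau>)\<bar>) \<le> 4 * (real p)\<^sup>2"
proof -
  have "card (SL2_mod p) > 0"
    using card_SL2_mod_prime[OF assms(1)] prime_gt_1_nat[OF assms(1)] by simp
  then have c: "real (card (SL2_mod p)) * rho_prime p = real (num_ff p)" by (auto simp: rho_prime_eq[OF assms(1)])
  have "(\<Sum>g\<in>SL2_mod p. \<bar>Xi p (ff g - \<tau>)\<bar>) \<le> (\<Sum>g\<in>SL2_mod p. of_bool [ff g - \<tau> = 0] (mod int p) + rho_prime p)"
    using rho_prime_bounds[OF assms(1)] by (intro sum_mono) (simp add: Xi_prime[OF assms(1)] abs_le_iff)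
  also have "\<dots> = 2 * real (num_ff p)"
    using c by (simp add: sum.distrib sum_of_bool_ff[OF assms])
  also have "\<dots> \<le> 2 * (2 * (real p)\<^sup>2)"
    using num_ff_le[OF assms(1)] by (metis (mono_tags) mult_left_mono of_nat_le_iff of_nat_mult of_nat_numeral of_nat_power zero_le_numeral)
  finally show ?thesis by simp
qed

text \<open>Splits off one prime at a time; square-freeness makes it coprime to the cofactor, which
  is what the multiplicativity lemmas require.\<close>

lemma squarefree_prime_induct [consumes 1, case_names one step]:
  fixes n :: nat
  assumes "squarefree n" "P 1"
    and "\<And>p m. prime p \<Longrightarrow> squarefree m \<Longrightarrow> coprime p m \<Longrightarrow> squarefree (p * m) \<Longrightarrow> P m \<Longrightarrow> P (p * m)"
  shows "P n"
  using assms(1)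
proof (induction n rule: less_induct)
  case (less n)
  show ?case
  proof (cases "n = 1")
    case False
    then obtain p where p: "prime p" "p dvd n" using prime_factor_nat by blast
    then obtain m where m: "n = p * m" by blast
    have sm: "squarefree m" "m \<noteq> 0"
      using less.prems m squarefree_multD(2) not_squarefree_0 by (blast, metis mult_0_right)
    have "\<not> p dvd m"
    proof
      assume "p dvd m"
      then have "p\<^sup>2 dvd n" using m by (simp add: power2_eq_square)
      then show False using less.prems p(1) by (auto simp: squarefree_def)
    qed
    then have "coprime p m" using p(1) prime_imp_coprime by blast
    moreover have "m < n" using m sm p(1) prime_gt_1_nat by simp
    ultimately show ?thesis using assms(3)[OF p(1) sm(1)] less m sm(1) by blast
  qed (use assms(2) in simp)
qed

text \<open>One prime factor of mean zero makes the whole product vanish. The case d = 1 is excluded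
  because \<open>Xi 1\<close> is the empty product 1.\<close>

lemma sum_Xi_eq_0:
  assumes "squarefree d" "d \<noteq> 1" "[\<tau>\<^sup>2 = 4] (mod int d)"
  shows "(\<Sum>g\<in>SL2_mod d. Xi d (ff g - \<tau>)) = 0"
proof -
  have "d \<noteq> 1 \<longrightarrow> [\<tau>\<^sup>2 = 4] (mod int d) \<longrightarrow> (\<Sum>g\<in>SL2_mod d. Xi d (ff g - \<tau>)) = 0"
    using assms(1)
  proof (induction rule: squarefree_prime_induct)
    case (step p m)
    have pos: "p > 0" "m > 0" using step prime_gt_0_nat by (auto intro!: Nat.gr0I)
    show ?case
    proof (intro impI)
      assume "[\<tau>\<^sup>2 = 4] (mod int (p * m))"
      then have "[\<tau>\<^sup>2 = 4] (mod int p)" by (auto intro: cong_dvd_modulus)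
      then have "(\<Sum>g\<in>SL2_mod p. Xi p (ff g - \<tau>)) = 0" using step sum_Xi_prime_eq_0 by blast
      then show "(\<Sum>g\<in>SL2_mod (p * m). Xi (p * m) (ff g - \<tau>)) = 0"
        using sum_SL2_mod_mult[OF pos step(3), of "\<lambda>g. Xi p (ff g - \<tau>)" "\<lambda>g. Xi m (ff g - \<tau>)"] Xi_ff_mat_cong
        by (simp add: Xi_mult[OF pos step(3)])
    qed
  qed simp
  then show ?thesis using assms by blast
qed

text \<open>The function usually written omega(n). Its exponentials \<open>b ^ num_primes n\<close>
  take the place of divisor functions in all bounds below.\<close>

definition num_primes :: "nat \<Rightarrow> nat" where
  "num_primes n = card (prime_factors n)"

lemma num_primes_mult:
  assumes "m > 0" "n > 0" "coprime m n"
  shows "num_primes (m * n) = num_primes m + num_primes n"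
  unfolding num_primes_def prime_factors_mult_coprime(1)[OF assms]
  by (rule card_Un_disjoint) (use prime_factors_mult_coprime(2)[OF assms] in auto)

lemma num_primes_prime: "prime p \<Longrightarrow> num_primes p = 1"
  by (simp add: num_primes_def prime_prime_factors)

lemma num_primes_1 [simp]: "num_primes (Suc 0) = 0"
  by (simp add: num_primes_def)

lemma sum_abs_Xi_le:
  assumes "squarefree d" "[\<tau>\<^sup>2 = 4] (mod int d)"
  shows "(\<Sum>g\<in>SL2_mod d. \<bar>Xi d (ff g - \<tau>)\<bar>) \<le> 4 ^ num_primes d * (real d)\<^sup>2"
proof -
  have "[\<tau>\<^sup>2 = 4] (mod int d) \<longrightarrow> (\<Sum>g\<in>SL2_mod d. \<bar>Xi d (ff g - \<tau>)\<bar>) \<le> 4 ^ num_primes d * (real d)\<^sup>2"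
    using assms(1)
  proof (induction rule: squarefree_prime_induct)
    case one
    have "(0 \<le> x \<and> x < 1) = (x = 0)" for x :: int by linarith
    \<comment> \<open>Modulo 1 the only residue matrix is the zero matrix, whose determinant 0 is
      congruent to 1.\<close>
    then have "SL2_mod 1 \<subseteq> {0}" by (auto simp: SL2_mod_def vec_eq_iff)
    moreover have "0 \<in> SL2_mod 1" by (simp add: SL2_mod_def)
    ultimately have "SL2_mod 1 = {0}" by blast
    then show ?case by (simp add: Xi_def)
  next
    case (step p m)
    have pos: "p > 0" "m > 0" using step prime_gt_0_nat by (auto intro!: Nat.gr0I)
    show ?case
    proof (intro impI)
      assume t: "[\<tau>\<^sup>2 = 4] (mod int (p * m))"
      then have 1: "[\<tau>\<^sup>2 = 4] (mod int p)" by (auto intro: cong_dvd_modulus)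
      have 2: "[\<tau>\<^sup>2 = 4] (mod int m)" using t by (auto intro: cong_dvd_modulus)
      have "(\<Sum>g\<in>SL2_mod (p * m). \<bar>Xi (p * m) (ff g - \<tau>)\<bar>) =
          (\<Sum>g\<in>SL2_mod p. \<bar>Xi p (ff g - \<tau>)\<bar>) * (\<Sum>g\<in>SL2_mod m. \<bar>Xi m (ff g - \<tau>)\<bar>)"
        using sum_SL2_mod_mult[OF pos step(3), of "\<lambda>g. \<bar>Xi p (ff g - \<tau>)\<bar>" "\<lambda>g. \<bar>Xi m (ff g - \<tau>)\<bar>"]
          Xi_ff_mat_cong by (simp add: Xi_mult[OF pos step(3)] abs_mult)
      also have "\<dots> \<le> (4 * (real p)\<^sup>2) * (4 ^ num_primes m * (real m)\<^sup>2)"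
        using sum_abs_Xi_prime_le[OF step(1) 1] step(5) 2 by (intro mult_mono sum_nonneg) auto
      also have "\<dots> = 4 ^ num_primes (p * m) * (real (p * m))\<^sup>2"
        by (simp add: num_primes_mult[OF pos step(3)] num_primes_prime[OF step(1)] power_mult_distrib)
      finally show "(\<Sum>g\<in>SL2_mod (p * m). \<bar>Xi (p * m) (ff g - \<tau>)\<bar>) \<le> \<dots>" .
    qed
  qed
  then show ?thesis using assms by blast
qed

section \<open>Multiplicativity and bounds for the number of roots of 4, \<open>rho\<close> and
  \<open>beta\<close>\<close>

lemma card_roots4_mult:
  assumes "m > 0" "n > 0" "coprime m n"
  shows "card (roots4 (m * n)) = card (roots4 m) * card (roots4 n)"
proof -
  have cop: "coprime (int m) (int n)" using assms by simp
  have sq: "[(x mod q)\<^sup>2 = x\<^sup>2] (mod q)" for x q :: int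
    by (intro cong_pow) (simp add: cong_def)
  have "bij_betw (\<lambda>x. (x mod int m, x mod int n)) (roots4 (m * n)) (roots4 m \<times> roots4 n)"
    unfolding bij_betw_def
  proof (intro conjI inj_onI equalityI subsetI)
    fix x y assume xy: "x \<in> roots4 (m * n)" "y \<in> roots4 (m * n)"
      and "(x mod int m, x mod int n) = (y mod int m, y mod int n)"
    then have "[x = y] (mod int m)" "[x = y] (mod int n)" by (auto simp: cong_def)
    then have "[x = y] (mod int m * int n)" using cop by (rule coprime_cong_mult)
    then show "x = y" using xy by (auto simp: roots4_def cong_def)
  next
    fix w assume "w \<in> (\<lambda>x. (x mod int m, x mod int n)) ` roots4 (m * n)"
    then obtain x where x: "w = (x mod int m, x mod int n)" "[x\<^sup>2 = 4] (mod int m * int n)"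
      by (auto simp: roots4_def)
    then have "[x\<^sup>2 = 4] (mod int m)" "[x\<^sup>2 = 4] (mod int n)" by (auto intro: cong_dvd_modulus)
    then show "w \<in> roots4 m \<times> roots4 n"
      using x(1) assms sq by (auto simp: roots4_def intro: cong_trans)
  next
    fix w assume "w \<in> roots4 m \<times> roots4 n"
    then obtain a b where ab: "w = (a, b)" "a \<in> roots4 m" "b \<in> roots4 n" by auto
    obtain x where x: "[x = a] (mod int m)" "[x = b] (mod int n)"
      using binary_chinese_remainder_int[OF cop] by blast
    have "[x\<^sup>2 = 4] (mod int m)" "[x\<^sup>2 = 4] (mod int n)"
      using cong_pow[OF x(1), of 2] cong_pow[OF x(2), of 2] ab by (auto simp: roots4_def intro: cong_trans)
    then have "[x\<^sup>2 = 4] (mod int m * int n)" using cop by (rule coprime_cong_mult)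
    then have r: "x mod (int m * int n) \<in> roots4 (m * n)"
      using assms cong_trans[OF sq] by (auto simp: roots4_def)
    have "x mod (int m * int n) mod int m = a" "x mod (int m * int n) mod int n = b"
      using x ab by (auto simp: roots4_def cong_def mod_mod_cancel)
    then show "w \<in> (\<lambda>x. (x mod int m, x mod int n)) ` roots4 (m * n)"
      using r ab(1) by (intro rev_image_eqI[OF r]) simp
  qed
  then show ?thesis using bij_betw_same_card card_cartesian_product by metis
qed

lemma rho_mult:
  assumes "m > 0" "n > 0" "coprime m n"
  shows "rho (m * n) = rho m * rho n"
  unfolding rho_def prime_factors_mult_coprime(1)[OF assms]
  by (rule prod.union_disjoint) (use prime_factors_mult_coprime(2)[OF assms] in auto)

lemma beta_mult:
  assumes "m > 0" "n > 0" "coprime m n"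
  shows "beta (m * n) = beta m * beta n"
  unfolding beta_def prime_factors_mult_coprime(1)[OF assms]
  by (rule prod.union_disjoint) (use prime_factors_mult_coprime(2)[OF assms] in auto)

lemma roots4_1: "roots4 (Suc 0) = {0}"
  by (auto simp: roots4_def)

lemma beta_eq:
  assumes "squarefree q"
  shows "beta q = real (card (roots4 q)) * rho q"
  using assms
proof (induction rule: squarefree_prime_induct)
  case one
  then show ?case by (simp add: beta_def rho_def roots4_1)
next
  case (step p m)
  have pos: "p > 0" "m > 0" using step prime_gt_0_nat by (auto intro!: Nat.gr0I)
  show ?case
    using step(5) beta_prime_eq[OF step(1)]
    by (simp add: beta_mult[OF pos step(3)] rho_mult[OF pos step(3)] card_roots4_mult[OF pos step(3)],
        simp add: beta_def rho_def prime_prime_factors[OF step(1)])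
qed

lemma card_roots4_le:
  assumes "squarefree q"
  shows "card (roots4 q) \<le> 2 ^ num_primes q"
  using assms
proof (induction rule: squarefree_prime_induct)
  case one
  then show ?case by (simp add: roots4_1)
next
  case (step p m)
  have pos: "p > 0" "m > 0" using step prime_gt_0_nat by (auto intro!: Nat.gr0I)
  have "card (roots4 p) \<le> 2" using card_roots4_prime[OF step(1)] by simp
  then have "card (roots4 p) * card (roots4 m) \<le> 2 * 2 ^ num_primes m"
    using step(5) by (rule mult_mono) auto
  then show ?case
    by (simp add: card_roots4_mult[OF pos step(3)] num_primes_mult[OF pos step(3)] num_primes_prime[OF step(1)])
qed

lemma rho_nonneg: "0 \<le> rho q"
  unfolding rho_def by (intro prod_nonneg ballI rho_prime_bounds) auto

text \<open>The decay 1/q is what later leaves only a harmonic sum over the cofactors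
  \<open>q div d\<close>.\<close>

lemma rho_le:
  assumes "squarefree q"
  shows "rho q \<le> 2 ^ num_primes q / real q"
  using assms
proof (induction rule: squarefree_prime_induct)
  case one
  then show ?case by (simp add: rho_def)
next
  case (step p m)
  have pos: "p > 0" "m > 0" using step prime_gt_0_nat by (auto intro!: Nat.gr0I)
  have "rho p \<le> 2 / real p"
    using rho_prime_bounds(2)[OF step(1)] by (simp add: rho_def prime_prime_factors[OF step(1)])
  then have "rho p * rho m \<le> (2 / real p) * (2 ^ num_primes m / real m)"
    using step(5) rho_nonneg by (intro mult_mono) auto
  then show ?case
    by (simp add: rho_mult[OF pos step(3)] num_primes_mult[OF pos step(3)] num_primes_prime[OF step(1)])
qed

section \<open>Equidistribution over the product set\<close>

lemma gen_mat_mult_nth [simp]: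
  "(gen_mat a ** M) $ 1 $ j = int a * M $ 1 $ j + M $ 2 $ j"
  "(gen_mat a ** M) $ 2 $ j = M $ 1 $ j"
  by (simp_all add: gen_mat_def matrix_matrix_mult_def sum_2)

text \<open>The row sums are the image of the vector (1, 1), and \<open>gen_mat a\<close> sends (s,
  t) to (as + t, s). Starting from (1, 1) keeps both entries positive, and the strict inequality
  separates nonempty words from the empty one.\<close>

lemma word_mat_row_sums:
  assumes "\<forall>a\<in>set w. 1 \<le> a"
  defines "M \<equiv> word_mat w"
  shows "1 \<le> M $ 2 $ 1 + M $ 2 $ 2" "M $ 2 $ 1 + M $ 2 $ 2 \<le> M $ 1 $ 1 + M $ 1 $ 2"
    "w \<noteq> [] \<Longrightarrow> M $ 2 $ 1 + M $ 2 $ 2 < M $ 1 $ 1 + M $ 1 $ 2"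
proof -
  have "1 \<le> word_mat w $ 2 $ 1 + word_mat w $ 2 $ 2 \<and>
      word_mat w $ 2 $ 1 + word_mat w $ 2 $ 2 \<le> word_mat w $ 1 $ 1 + word_mat w $ 1 $ 2 \<and>
      (w \<noteq> [] \<longrightarrow> word_mat w $ 2 $ 1 + word_mat w $ 2 $ 2 < word_mat w $ 1 $ 1 + word_mat w $ 1 $ 2)"
    using assms(1)
  proof (induction w)
    case Nil
    then show ?case by (simp add: mat_def)
  next
    case (Cons a w)
    let ?s = "word_mat w $ 1 $ 1 + word_mat w $ 1 $ 2"
    have "1 * ?s \<le> int a * ?s" using Cons by (intro mult_right_mono) auto
    then show ?case using Cons by (simp add: distrib_left)
  qed
  then show "1 \<le> M $ 2 $ 1 + M $ 2 $ 2" "M $ 2 $ 1 + M $ 2 $ 2 \<le> M $ 1 $ 1 + M $ 1 $ 2"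
    "w \<noteq> [] \<Longrightarrow> M $ 2 $ 1 + M $ 2 $ 2 < M $ 1 $ 1 + M $ 1 $ 2"
    unfolding M_def by auto
qed

text \<open>Prepending the letter \<open>a\<close> turns the row sums \<open>s \<ge> t \<ge> 1\<close> into \<open>a s + t\<close> and \<open>s\<close>, so \<open>a\<close> is
  recovered by division with remainder in \<open>{1..s}\<close>.\<close>

lemma word_mat_inject:
  assumes "\<forall>a\<in>set v. 1 \<le> a" "\<forall>a\<in>set w. 1 \<le> a" "word_mat v = word_mat w"
  shows "v = w"
  using assms
proof (induction v arbitrary: w)
  case Nil
  show ?case
  proof (rule ccontr)
    assume "[] \<noteq> w"
    then have "word_mat [] $ 2 $ 1 + word_mat [] $ 2 $ 2 < word_mat [] $ 1 $ 1 + word_mat [] $ 1 $ 2"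
      using word_mat_row_sums(3)[OF Nil(2)] unfolding Nil(3) by blast
    then show False by (simp add: mat_def)
  qed
next
  case (Cons a v)
  have "w \<noteq> []"
  proof
    assume "w = []"
    then have "word_mat [] $ 2 $ 1 + word_mat [] $ 2 $ 2 < word_mat [] $ 1 $ 1 + word_mat [] $ 1 $ 2"
      using word_mat_row_sums(3)[OF Cons.prems(1)] unfolding Cons.prems(3) by blast
    then show False by (simp add: mat_def)
  qed
  then obtain b u where w: "w = b # u" by (meson neq_Nil_conv)
  define M M' where "M = word_mat v" and "M' = word_mat u"
  have eq: "gen_mat a ** M = gen_mat b ** M'" using Cons.prems w by (simp add: M_def M'_def)
  have r1: "M $ 1 $ j = M' $ 1 $ j" for j using arg_cong[OF eq, of "\<lambda>g. g $ 2 $ j"] by simp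
  have r2: "int a * M $ 1 $ j + M $ 2 $ j = int b * M' $ 1 $ j + M' $ 2 $ j" for j
    using arg_cong[OF eq, of "\<lambda>g. g $ 1 $ j"] by simp
  define s t t' where "s = M $ 1 $ 1 + M $ 1 $ 2" and "t = M $ 2 $ 1 + M $ 2 $ 2"
    and "t' = M' $ 2 $ 1 + M' $ 2 $ 2"
  have b: "1 \<le> t" "t \<le> s" "1 \<le> t'" "t' \<le> s"
    using word_mat_row_sums[of v] word_mat_row_sums[of u] Cons.prems w r1
    by (auto simp: s_def t_def t'_def M_def M'_def)
  have e: "int a * s + t = int b * s + t'"
    using r2[of 1] r2[of 2] r1 unfolding s_def t_def t'_def by (simp add: algebra_simps)
  have "a = b"
  proof (rule linorder_cases[of a b])
    assume "a < b"
    then have "(int a + 1) * s \<le> int b * s" using b by (intro mult_right_mono) auto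
    then show ?thesis using e b by (simp add: distrib_right)
  next
    assume "b < a"
    then have "(int b + 1) * s \<le> int a * s" using b by (intro mult_right_mono) auto
    then show ?thesis using e b by (simp add: distrib_right)
  qed
  moreover have "M = M'"
    using r1 r2 \<open>a = b\<close> by (simp add: vec_eq_iff forall_2)
  ultimately show ?case using Cons w by (simp add: M_def M'_def)
qed

lemma word_mat_append: "word_mat (u @ v) = word_mat u ** word_mat v"
  by (induction u) (simp_all add: matrix_mul_assoc)

lemma det_word_mat: "det (word_mat w) = (-1) ^ length w"
proof (induction w)
  case (Cons a w)
  have "det (gen_mat a) = -1" by (simp add: gen_mat_def det_2)
  then show ?case using Cons by (simp add: det_mul)
qed simp

lemma Gamma_semi_det: "g \<in> Gamma_semi A \<Longrightarrow> det g = 1"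
  by (auto simp: Gamma_semi_def Gamma_words_def det_word_mat)

lemma frob_norm_eq: "frob_norm g = sqrt (real_of_int (ff g))"
  by (simp add: frob_norm_def ff_def trace_def matrix_matrix_mult_def transpose_def sum_2 power2_eq_square algebra_simps)

text \<open>Each entry is bounded by the Frobenius norm. This makes \<open>\<AA>\<close> finite, so
  that grouping its elements by residue class is legitimate.\<close>

lemma finite_norm_ball: "finite (norm_ball Y)"
proof -
  define k where "k = \<lceil>Y\<rceil>"
  let ?B = "{-k..k}"
  have "norm_ball Y \<subseteq> (\<lambda>((a, b), (c, d)). vector [vector [a, b], vector [c, d]]) ` ((?B \<times> ?B) \<times> (?B \<times> ?B))"
  proof
    fix g assume "g \<in> norm_ball Y"
    then have n: "sqrt (real_of_int (ff g)) < Y" by (simp add: norm_ball_def frob_norm_eq)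
    have bound: "x \<in> ?B" if "x\<^sup>2 \<le> ff g" for x
    proof -
      have "\<bar>real_of_int x\<bar> = sqrt (real_of_int (x\<^sup>2))" by simp
      also have "\<dots> \<le> sqrt (real_of_int (ff g))" using that by (simp only: real_sqrt_le_iff of_int_le_iff)
      also have "\<dots> \<le> real_of_int k" using n unfolding k_def by linarith
      finally show ?thesis unfolding atLeastAtMost_iff by linarith
    qed
    have "g $ 1 $ 1 \<in> ?B" "g $ 1 $ 2 \<in> ?B" "g $ 2 $ 1 \<in> ?B" "g $ 2 $ 2 \<in> ?B"
      by (rule bound, simp add: ff_def)+
    moreover have "g = vector [vector [g $ 1 $ 1, g $ 1 $ 2], vector [g $ 2 $ 1, g $ 2 $ 2]]"
      by (simp add: vec_eq_iff forall_2)
    ultimately show "g \<in> (\<lambda>((a, b), (c, d)). vector [vector [a, b], vector [c, d]]) ` ((?B \<times> ?B) \<times> (?B \<times> ?B))"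
      by (intro rev_image_eqI[of "((g $ 1 $ 1, g $ 1 $ 2), (g $ 2 $ 1, g $ 2 $ 2))"]) auto
  qed
  then show ?thesis by (rule finite_subset) simp
qed

text \<open>The product determines the concatenated word, and the common lengths l and l' tell where
  to cut it: a prefix of length l, a suffix of length l', and a middle part of arbitrary
  length.\<close>

lemma inj_on_triple_product:
  assumes X: "\<Omega>X \<subseteq> Gamma_words A l" and Z: "\<Omega>Z \<subseteq> Gamma_words A l'" and \<AA>: "\<AA> \<subseteq> Gamma_semi B"
  shows "inj_on (\<lambda>(x, a, z). x ** a ** z) (\<Omega>X \<times> \<AA> \<times> \<Omega>Z)"
proof (rule inj_onI)
  fix s t assume st: "s \<in> \<Omega>X \<times> \<AA> \<times> \<Omega>Z" "t \<in> \<Omega>X \<times> \<AA> \<times> \<Omega>Z"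
    "(\<lambda>(x, a, z). x ** a ** z) s = (\<lambda>(x, a, z). x ** a ** z) t"
  obtain x a z where s: "s = (x, a, z)" by (metis prod.collapse)
  obtain x' a' z' where t: "t = (x', a', z')" by (metis prod.collapse)
  have m: "x \<in> \<Omega>X" "a \<in> \<AA>" "z \<in> \<Omega>Z" "x' \<in> \<Omega>X" "a' \<in> \<AA>" "z' \<in> \<Omega>Z"
    and eq: "x ** a ** z = x' ** a' ** z'"
    using st unfolding s t by auto
  obtain u u' where u: "x = word_mat u" "x' = word_mat u'" "length u = l" "length u' = l"
    "set u \<subseteq> {1..A}" "set u' \<subseteq> {1..A}"
    using X m unfolding Gamma_words_def by blast
  obtain w w' where w: "z = word_mat w" "z' = word_mat w'" "length w = l'" "length w' = l'"
    "set w \<subseteq> {1..A}" "set w' \<subseteq> {1..A}"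
    using Z m unfolding Gamma_words_def by blast
  obtain v v' where v: "a = word_mat v" "a' = word_mat v'" "set v \<subseteq> {1..B}" "set v' \<subseteq> {1..B}"
    using \<AA> m unfolding Gamma_semi_def Gamma_words_def by blast
  have "u @ v @ w = u' @ v' @ w'"
  proof (rule word_mat_inject)
    show "word_mat (u @ v @ w) = word_mat (u' @ v' @ w')"
      using eq by (simp add: u v w word_mat_append matrix_mul_assoc)
  qed (use u v w in auto)
  then have "u = u'" "v = v'" "w = w'" using u w by auto
  then show "s = t" using u v w s t by simp
qed

section \<open>From averages over residue classes to sums over the product set\<close>

lemma SL2_int_inverse:
  fixes x :: "int^2^2"
  assumes "det x = 1"
  obtains y where "y ** x = mat 1" "x ** y = mat 1"
proof
  let ?y = "vector [vector [x $ 2 $ 2, - x $ 1 $ 2], vector [- x $ 2 $ 1, x $ 1 $ 1]] :: int^2^2"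
  have d: "x $ 1 $ 1 * x $ 2 $ 2 - x $ 1 $ 2 * x $ 2 $ 1 = 1" using assms by (simp add: det_2)
  show "?y ** x = mat 1" "x ** ?y = mat 1"
    using d by (simp_all add: vec_eq_iff forall_2 matrix_matrix_mult_def sum_2 mat_def algebra_simps)
qed

text \<open>Multiplication by x and z permutes the residue group, since the integral inverses undo
  it modulo q. This makes the later bound uniform in x and z.\<close>

lemma sum_SL2_mod_translate:
  fixes H :: "int^2^2 \<Rightarrow> real"
  assumes "q > 0" "det x = 1" "det z = 1" and H: "\<And>g h. mat_cong q g h \<Longrightarrow> H g = H h"
  shows "(\<Sum>g\<in>SL2_mod q. H (x ** g ** z)) = (\<Sum>g\<in>SL2_mod q. H g)"
proof -
  let ?f = "\<lambda>g. mat_mod q (x ** g ** z)"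
  obtain x' where x': "x' ** x = mat 1" using SL2_int_inverse assms(2) by blast
  obtain z' where z': "z ** z' = mat 1" using SL2_int_inverse assms(3) by blast
  have cancel: "x' ** (x ** g ** z) ** z' = g" for g
    by (metis x' z' matrix_mul_assoc matrix_mul_lid matrix_mul_rid)
  have "inj_on ?f (SL2_mod q)"
  proof (rule inj_onI)
    fix g h assume gh: "g \<in> SL2_mod q" "h \<in> SL2_mod q" "?f g = ?f h"
    then have "mat_cong q (x ** g ** z) (x ** h ** z)" by (simp add: mat_cong_iff_mat_mod_eq)
    then have "mat_cong q (x' ** (x ** g ** z) ** z') (x' ** (x ** h ** z) ** z')"
      by (rule mat_cong_mult[OF mat_cong_mult[OF mat_cong_refl] mat_cong_refl])
    then show "g = h" using gh unfolding cancel by (metis mat_cong_iff_mat_mod_eq mat_mod_SL2_mod)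
  qed
  moreover have "?f ` SL2_mod q \<subseteq> SL2_mod q"
  proof (rule image_subsetI)
    fix g assume "g \<in> SL2_mod q"
    then have "[det (x ** g ** z) = 1] (mod q)" using assms(2,3) by (simp add: det_mul SL2_mod_def)
    then show "?f g \<in> SL2_mod q" using assms(1) by (rule mat_mod_in_SL2_mod[rotated])
  qed
  ultimately have "bij_betw ?f (SL2_mod q) (SL2_mod q)"
    by (simp add: bij_betw_def endo_inj_surj)
  then have "(\<Sum>g\<in>SL2_mod q. H g) = (\<Sum>g\<in>SL2_mod q. H (?f g))"
    by (rule sum.reindex_bij_betw[symmetric])
  then show ?thesis using H[OF mat_cong_mat_mod] by simp
qed

text \<open>\<open>\<AA>\<close> is grouped by residue class, so that only the deviations of the
  class sizes from their expected common value matter; each deviation is bounded by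
  hypothesis.\<close>

lemma equidistributed_sum_bound:
  fixes H :: "int^2^2 \<Rightarrow> real"
  assumes eq: "equidistributed C0 \<Theta> K Y \<AA>" and fin: "finite \<AA>" and det: "\<forall>a\<in>\<AA>. det a = 1"
    and q: "q \<ge> 1" and H: "\<And>g h. mat_cong q g h \<Longrightarrow> H g = H h"
    and zero: "(\<Sum>g\<in>SL2_mod q. H g) = 0"
  shows "\<bar>\<Sum>a\<in>\<AA>. H a\<bar> \<le> K * real (card \<AA>) * real q powr C0 * Y powr (-\<Theta>) * (\<Sum>g\<in>SL2_mod q. \<bar>H g\<bar>)"
proof -
  define E where "E = K * real (card \<AA>) * real q powr C0 * Y powr (-\<Theta>)"
  define N where "N = (\<lambda>g. real (card {a\<in>\<AA>. mat_cong q a g}))"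
  define \<mu> where "\<mu> = real (card \<AA>) / real (card (SL2_mod q))"
  have "(\<Sum>a\<in>\<AA>. H a) = (\<Sum>g\<in>SL2_mod q. \<Sum>a\<in>{a\<in>\<AA>. mat_mod q a = g}. H a)"
    using q det fin by (intro sum.group[symmetric]) (auto intro!: mat_mod_in_SL2_mod)
  also have "\<dots> = (\<Sum>g\<in>SL2_mod q. N g * H g)"
  proof (intro sum.cong refl)
    fix g assume g: "g \<in> SL2_mod q"
    then have s: "{a\<in>\<AA>. mat_mod q a = g} = {a\<in>\<AA>. mat_cong q a g}"
      using mat_mod_SL2_mod[OF g] by (auto simp: mat_cong_iff_mat_mod_eq)
    have "(\<Sum>a\<in>{a\<in>\<AA>. mat_cong q a g}. H a) = (\<Sum>a\<in>{a\<in>\<AA>. mat_cong q a g}. H g)"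
      by (intro sum.cong refl H) simp
    then show "(\<Sum>a\<in>{a\<in>\<AA>. mat_mod q a = g}. H a) = N g * H g"
      unfolding s by (simp add: N_def)
  qed
  \<comment> \<open>The expected size \<open>\<mu>\<close> may be subtracted because it multiplies
    the vanishing total of \<open>H\<close>.\<close>
  also have "\<dots> = (\<Sum>g\<in>SL2_mod q. (N g - \<mu>) * H g)"
    using zero by (simp add: left_diff_distrib sum_subtractf flip: sum_distrib_left)
  also have "\<bar>\<dots>\<bar> \<le> (\<Sum>g\<in>SL2_mod q. \<bar>N g - \<mu>\<bar> * \<bar>H g\<bar>)"
    by (rule order_trans[OF sum_abs]) (simp add: abs_mult)
  also have "\<dots> \<le> (\<Sum>g\<in>SL2_mod q. E * \<bar>H g\<bar>)"
  proof (intro sum_mono mult_right_mono abs_ge_zero)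
    show "\<bar>N g - \<mu>\<bar> \<le> E" if "g \<in> SL2_mod q" for g
      using eq q that unfolding equidistributed_def N_def \<mu>_def E_def by blast
  qed
  finally show ?thesis by (simp add: E_def sum_distrib_left)
qed

text \<open>Injectivity of the triple product is used twice: to unfold the sum over
  \<open>\<phi>\<close> into sums over x, a and z, and to recombine the three cardinalities into
  that of the product set.\<close>

lemma sum_Xi_prod_set_bound:
  assumes eq: "equidistributed C0 \<Theta> K Y \<AA>" and K: "K > 0"
    and X: "\<Omega>X \<subseteq> Gamma_words A l" "\<Omega>X \<subseteq> Gamma_semi A"
    and Z: "\<Omega>Z \<subseteq> Gamma_words A l'" "\<Omega>Z \<subseteq> Gamma_semi A"
    and \<AA>: "\<AA> \<subseteq> Gamma_semi 2" "finite \<AA>"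
    and d: "squarefree d" "d \<noteq> 1" and \<tau>: "[\<tau>\<^sup>2 = 4] (mod int d)"
  shows "\<bar>\<Sum>\<phi>\<in>prod_set \<Omega>X \<AA> \<Omega>Z. Xi d (ff \<phi> - \<tau>)\<bar> \<le>
    K * real (card (prod_set \<Omega>X \<AA> \<Omega>Z)) * real d powr C0 * Y powr (-\<Theta>) * (4 ^ num_primes d * (real d)\<^sup>2)"
proof -
  define H where "H = (\<lambda>g. Xi d (ff g - \<tau>))"
  define E where "E = K * real (card \<AA>) * real d powr C0 * Y powr (-\<Theta>) * (4 ^ num_primes d * (real d)\<^sup>2)"
  have d0: "d \<ge> 1" using d(1) by (cases d) auto
  have H: "H g = H h" if "mat_cong d g h" for g h
    unfolding H_def using that by (rule Xi_ff_mat_cong)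
  let ?m = "\<lambda>(x, a, z). x ** a ** z"
  have P: "prod_set \<Omega>X \<AA> \<Omega>Z = ?m ` (\<Omega>X \<times> \<AA> \<times> \<Omega>Z)"
    by (force simp: prod_set_def)
  have inj: "inj_on ?m (\<Omega>X \<times> \<AA> \<times> \<Omega>Z)" by (rule inj_on_triple_product[OF X(1) Z(1) \<AA>(1)])
  have card: "card (prod_set \<Omega>X \<AA> \<Omega>Z) = card \<Omega>X * (card \<AA> * card \<Omega>Z)"
    unfolding P card_image[OF inj] by (simp add: card_cartesian_product)
  have "(\<Sum>\<phi>\<in>prod_set \<Omega>X \<AA> \<Omega>Z. H \<phi>) = (\<Sum>(x, a, z)\<in>\<Omega>X \<times> \<AA> \<times> \<Omega>Z. H (x ** a ** z))"
    unfolding P sum.reindex[OF inj] by (simp add: case_prod_unfold)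
  also have "\<dots> = (\<Sum>x\<in>\<Omega>X. \<Sum>a\<in>\<AA>. \<Sum>z\<in>\<Omega>Z. H (x ** a ** z))"
    by (simp add: sum.cartesian_product)
  also have "\<dots> = (\<Sum>x\<in>\<Omega>X. \<Sum>z\<in>\<Omega>Z. \<Sum>a\<in>\<AA>. H (x ** a ** z))"
    by (intro sum.cong refl sum.swap)
  also have "\<bar>\<dots>\<bar> \<le> (\<Sum>x\<in>\<Omega>X. \<Sum>z\<in>\<Omega>Z. \<bar>\<Sum>a\<in>\<AA>. H (x ** a ** z)\<bar>)"
    by (rule order_trans[OF sum_abs sum_mono]) (rule sum_abs)
  also have "\<dots> \<le> (\<Sum>x\<in>\<Omega>X. \<Sum>z\<in>\<Omega>Z. E)"
  proof (intro sum_mono)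
    fix x z assume "x \<in> \<Omega>X" "z \<in> \<Omega>Z"
    then have xz: "det x = 1" "det z = 1" using X(2) Z(2) Gamma_semi_det by blast+
    have inv: "H (x ** g ** z) = H (x ** h ** z)" if "mat_cong d g h" for g h
      by (rule H[OF mat_cong_mult[OF mat_cong_mult[OF mat_cong_refl that] mat_cong_refl]])
    have abs_eq: "(\<Sum>g\<in>SL2_mod d. \<bar>H (x ** g ** z)\<bar>) = (\<Sum>g\<in>SL2_mod d. \<bar>H g\<bar>)"
      by (rule sum_SL2_mod_translate[where H = "\<lambda>g. \<bar>H g\<bar>"]) (use d0 xz H in auto)
    have "(\<Sum>g\<in>SL2_mod d. H (x ** g ** z)) = (\<Sum>g\<in>SL2_mod d. H g)"
      by (rule sum_SL2_mod_translate) (use d0 xz H in auto)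
    also have "\<dots> = 0" unfolding H_def by (rule sum_Xi_eq_0[OF d \<tau>])
    finally have "\<bar>\<Sum>a\<in>\<AA>. H (x ** a ** z)\<bar> \<le> K * real (card \<AA>) * real d powr C0 * Y powr (-\<Theta>) * (\<Sum>g\<in>SL2_mod d. \<bar>H (x ** g ** z)\<bar>)"
      using Gamma_semi_det \<AA> d0 inv by (intro equidistributed_sum_bound[OF eq]) auto
    also have "\<dots> \<le> E" unfolding abs_eq unfolding E_def H_def
      using K by (intro mult_left_mono sum_abs_Xi_le[OF d(1) \<tau>]) simp
    finally show "\<bar>\<Sum>a\<in>\<AA>. H (x ** a ** z)\<bar> \<le> E" .
  qed
  also have "\<dots> = K * real (card (prod_set \<Omega>X \<AA> \<Omega>Z)) * real d powr C0 * Y powr (-\<Theta>) * (4 ^ num_primes d * (real d)\<^sup>2)"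
    by (simp add: card E_def)
  finally show ?thesis by (simp add: H_def)
qed

section \<open>Summation over moduli\<close>

text \<open>The classical divisor-bound argument: a prime p at or above
  \<open>b powr (1 / \<eta>)\<close> satisfies \<open>b \<le> p powr \<eta>\<close> and pays for its
  own factor b. At most B smaller primes remain, and they cost at most the constant
  \<open>b ^ B\<close>.\<close>

lemma power_num_primes_le:
  fixes \<eta> b :: real
  assumes "\<eta> > 0" "b \<ge> 1"
  shows "\<exists>C>0. \<forall>n. squarefree n \<longrightarrow> b ^ num_primes n \<le> C * real n powr \<eta>"
proof -
  define B where "B = nat \<lceil>b powr (1 / \<eta>)\<rceil>"
  define s where "s n = card {p \<in> prime_factors n. p < B}" for n :: nat
  have big: "b \<le> real p powr \<eta>" if "\<not> p < B" for p
  proof -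
    have "b powr (1 / \<eta>) \<le> real p" using that unfolding B_def by linarith
    then have "(b powr (1 / \<eta>)) powr \<eta> \<le> real p powr \<eta>" using assms by (intro powr_mono2) auto
    then show ?thesis using assms by (simp add: powr_powr)
  qed
  have main: "b ^ num_primes n \<le> b ^ s n * real n powr \<eta>" if "squarefree n" for n
    using that
  proof (induction rule: squarefree_prime_induct)
    case one
    then show ?case by (simp add: s_def num_primes_def)
  next
    case (step p m)
    have pos: "p > 0" "m > 0" using step prime_gt_0_nat by (auto intro!: Nat.gr0I)
    have pf: "prime_factors (p * m) = insert p (prime_factors m)"
      using prime_factors_mult_coprime(1)[OF pos step(3)] step(1) by (simp add: prime_prime_factors)
    have pn: "p \<notin> prime_factors m"
      using prime_factors_mult_coprime(2)[OF pos step(3)] step(1) by (simp add: prime_prime_factors)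
    have num: "b ^ num_primes (p * m) = b * b ^ num_primes m"
      by (simp add: num_primes_mult[OF pos step(3)] num_primes_prime[OF step(1)])
    have pw: "real (p * m) powr \<eta> = real p powr \<eta> * real m powr \<eta>" by (simp add: powr_mult)
    show ?case
    proof (cases "p < B")
      case True
      then have "{r \<in> prime_factors (p * m). r < B} = insert p {r \<in> prime_factors m. r < B}"
        unfolding pf by auto
      then have "s (p * m) = Suc (s m)" using pn by (simp add: s_def)
      then have "b ^ s (p * m) * real (p * m) powr \<eta> = b * real p powr \<eta> * (b ^ s m * real m powr \<eta>)"
        unfolding pw by simp
      moreover have "b * 1 \<le> b * real p powr \<eta>"
        using pos assms by (intro mult_left_mono ge_one_powr_ge_zero) auto
      then have "b * b ^ num_primes m \<le> b * real p powr \<eta> * (b ^ s m * real m powr \<eta>)"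
        using step(5) assms by (intro mult_mono) auto
      ultimately show ?thesis using num by simp
    next
      case False
      then have "{r \<in> prime_factors (p * m). r < B} = {r \<in> prime_factors m. r < B}"
        unfolding pf by auto
      then have "b ^ s (p * m) * real (p * m) powr \<eta> = real p powr \<eta> * (b ^ s m * real m powr \<eta>)"
        unfolding pw s_def by simp
      moreover have "b * b ^ num_primes m \<le> real p powr \<eta> * (b ^ s m * real m powr \<eta>)"
        using step(5) assms big[OF False] by (intro mult_mono) auto
      ultimately show ?thesis using num by simp
    qed
  qed
  have "s n \<le> B" for n
  proof -
    have "s n \<le> card {..<B}" unfolding s_def by (rule card_mono) auto
    then show ?thesis by simp
  qed
  then have "b ^ s n * real n powr \<eta> \<le> b ^ B * real n powr \<eta>" for n
    using assms by (intro mult_right_mono power_increasing) auto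
  with main have "\<forall>n. squarefree n \<longrightarrow> b ^ num_primes n \<le> b ^ B * real n powr \<eta>"
    by (meson order_trans)
  then show ?thesis using assms by (intro exI[of _ "b ^ B"]) auto
qed

lemma finite_nat_less_real: "finite {n. real n < x \<and> P n}"
  by (rule finite_subset[of _ "{..nat \<lceil>x\<rceil>}"]) (auto, linarith)

text \<open>Writing 1/m as \<open>m powr \<eta>\<close> times \<open>m powr (- (1 + \<eta>))\<close>
  and bounding the first factor by \<open>x powr \<eta>\<close> leaves a convergent series.\<close>

lemma harmonic_sum_le:
  fixes \<eta> :: real
  assumes "\<eta> > 0"
  shows "\<exists>C>0. \<forall>x\<ge>1. (\<Sum>m\<in>{m::nat. real m < x \<and> m \<ge> 1}. 1 / real m) \<le> C * x powr \<eta>"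
proof -
  have sm: "summable (\<lambda>n. real n powr (- (1 + \<eta>)))" using assms by (simp add: summable_real_powr_iff)
  define S where "S = (\<Sum>n. real n powr (- (1 + \<eta>)))"
  have S0: "S \<ge> 0" unfolding S_def by (intro suminf_nonneg sm) simp
  have "(\<Sum>m\<in>{m. real m < x \<and> m \<ge> 1}. 1 / real m) \<le> (S + 1) * x powr \<eta>" if x: "x \<ge> 1" for x
  proof -
    have "(\<Sum>m\<in>{m. real m < x \<and> m \<ge> 1}. 1 / real m) \<le> (\<Sum>m\<in>{m. real m < x \<and> m \<ge> 1}. x powr \<eta> * real m powr (- (1 + \<eta>)))"
    proof (intro sum_mono)
      fix m assume m: "m \<in> {m. real m < x \<and> m \<ge> 1}"
      then have "1 / real m = real m powr \<eta> * real m powr (- (1 + \<eta>))"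
        by (simp flip: powr_add add: powr_minus_divide)
      also have "\<dots> \<le> x powr \<eta> * real m powr (- (1 + \<eta>))"
        using m assms by (intro mult_right_mono powr_mono2) auto
      finally show "1 / real m \<le> \<dots>" .
    qed
    also have "\<dots> = x powr \<eta> * (\<Sum>m\<in>{m. real m < x \<and> m \<ge> 1}. real m powr (- (1 + \<eta>)))"
      by (simp add: sum_distrib_left)
    also have "\<dots> \<le> x powr \<eta> * S"
      unfolding S_def by (intro mult_left_mono sum_le_suminf sm finite_nat_less_real) auto
    also have "\<dots> \<le> (S + 1) * x powr \<eta>" by (simp add: algebra_simps)
    finally show ?thesis .
  qed
  \<comment> \<open>The added 1 makes the constant strictly positive, as only
    \<open>S \<ge> 0\<close> has been shown.\<close>
  then show ?thesis using S0 by (intro exI[of _ "S + 1"]) auto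
qed

text \<open>The pair (q, d) is replaced by (d, m) with m = q/d. Enlarging the range to a full
  product separates the variables, and fewer than or equal to Q values of d, each contributing at
  most \<open>Q powr a\<close>, raise the exponent by 1.\<close>

lemma divisor_pair_sum_le:
  fixes x Q a :: real
  assumes "x \<ge> 1" "Q > 1" "a \<ge> 0"
  shows "(\<Sum>q\<in>{q. squarefree q \<and> real q < x}. \<Sum>d\<in>{d. d dvd q \<and> real d < Q}. real d powr a / real (q div d))
    \<le> Q powr (a + 1) * (\<Sum>m\<in>{m::nat. real m < x \<and> m \<ge> 1}. 1 / real m)"
proof -
  let ?S = "{q::nat. squarefree q \<and> real q < x}" and ?T = "\<lambda>q. {d. d dvd q \<and> real d < Q}"
  let ?D = "{d::nat. real d < Q \<and> d \<ge> 1}" and ?M = "{m::nat. real m < x \<and> m \<ge> 1}"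
  have fS: "finite ?S" using finite_nat_less_real[of x squarefree] by (simp add: conj_commute)
  have nz: "q \<noteq> 0" if "q \<in> ?S" for q using that by (auto intro: Nat.gr0I)
  have fT: "finite (?T q)" if "q \<in> ?S" for q
    using nz[OF that] by (intro finite_subset[OF _ finite_divisors_nat[of q]]) auto
  have inj: "inj_on (\<lambda>(q, d). (d, q div d)) (SIGMA q:?S. ?T q)"
    by (rule inj_onI) (auto, metis dvd_mult_div_cancel)
  have img: "(\<lambda>(q, d). (d, q div d)) ` (SIGMA q:?S. ?T q) \<subseteq> ?D \<times> ?M"
  proof (clarify, intro conjI SigmaI CollectI)
    fix q d assume h: "squarefree q" "real q < x" "d dvd q" "real d < Q"
    then have q0: "q > 0" by (auto intro: Nat.gr0I)
    show "real d < Q" by fact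
    show "1 \<le> d" using h q0 by (metis dvd_0_left_iff less_one not_le not_less_zero)
    have "q div d \<le> q" by simp
    then show "real (q div d) < x" using h(2) by (meson of_nat_le_iff order_le_less_trans)
    show "1 \<le> q div d" using h(3) q0 by (metis One_nat_def Suc_leI dvd_div_eq_0_iff neq0_conv)
  qed
  have "(\<Sum>q\<in>?S. \<Sum>d\<in>?T q. real d powr a / real (q div d)) =
      (\<Sum>(q, d)\<in>(SIGMA q:?S. ?T q). real d powr a / real (q div d))"
    using fS fT by (intro sum.Sigma) auto
  also have "\<dots> = (\<Sum>(d, m)\<in>(\<lambda>(q, d). (d, q div d)) ` (SIGMA q:?S. ?T q). real d powr a / real m)"
    unfolding sum.reindex[OF inj] by (simp add: case_prod_unfold)
  also have "\<dots> \<le> (\<Sum>(d, m)\<in>?D \<times> ?M. real d powr a / real m)"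
    using img by (intro sum_mono2 finite_cartesian_product finite_nat_less_real) auto
  also have "\<dots> = (\<Sum>d\<in>?D. real d powr a) * (\<Sum>m\<in>?M. 1 / real m)"
    by (simp add: sum_product sum.cartesian_product)
  also have "\<dots> \<le> Q powr (a + 1) * (\<Sum>m\<in>?M. 1 / real m)"
  proof (intro mult_right_mono sum_nonneg)
    have "(\<Sum>d\<in>?D. real d powr a) \<le> (\<Sum>d\<in>?D. Q powr a)"
      using assms by (intro sum_mono powr_mono2) auto
    also have "\<dots> = real (card ?D) * Q powr a" by simp
    also have "\<dots> \<le> Q * Q powr a"
    proof (intro mult_right_mono)
      have "?D \<subseteq> {1..nat \<lfloor>Q\<rfloor>}" by (auto simp: le_nat_floor)
      then have "card ?D \<le> nat \<lfloor>Q\<rfloor>" using card_mono[of "{1..nat \<lfloor>Q\<rfloor>}" ?D] by simp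
      then show "real (card ?D) \<le> Q" using assms(2) by linarith
    qed simp
    also have "\<dots> = Q powr (a + 1)" using assms by (simp add: powr_add)
    finally show "(\<Sum>d\<in>?D. real d powr a) \<le> Q powr (a + 1)" .
  qed simp
  finally show ?thesis .
qed

text \<open>The base 8 is 2 times 4: at most \<open>2 ^ num_primes q\<close> values of
  \<open>\<tau>\<close>, a factor \<open>4 ^ num_primes d\<close> from the L1 norm, and
  \<open>2 ^ num_primes (q div d)\<close> from \<open>rho\<close>. The exponent
  \<open>C0 + 2\<close> joins equidistribution with the d^2 of the L1 norm.\<close>

lemma main_M_error_bound:
  assumes eq: "equidistributed C0 \<Theta> K Y \<AA>" and K: "K > 0" and Q0: "Q0 > 1"
    and X: "\<Omega>X \<subseteq> Gamma_words A l" "\<Omega>X \<subseteq> Gamma_semi A"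
    and Z: "\<Omega>Z \<subseteq> Gamma_words A l'" "\<Omega>Z \<subseteq> Gamma_semi A"
    and \<AA>: "\<AA> \<subseteq> Gamma_semi 2" "finite \<AA>"
    and q: "squarefree q"
  defines "P \<equiv> prod_set \<Omega>X \<AA> \<Omega>Z"
  shows "\<bar>main_M Q0 P q - beta q * real (card P)\<bar> \<le>
    K * real (card P) * Y powr (-\<Theta>) * (8 ^ num_primes q *
      (\<Sum>d\<in>{d. d dvd q \<and> real d < Q0}. real d powr (C0 + 2) / real (q div d)))"
proof -
  let ?D = "{d. d dvd q \<and> real d < Q0}"
  define F where "F = (\<lambda>d. \<Sum>\<tau>\<in>roots4 q. \<Sum>\<phi>\<in>P. Xi d (ff \<phi> - \<tau>) * rho (q div d))"
  have q0: "q > 0" using q by (auto intro: Nat.gr0I)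
  have fin: "finite ?D" using q0 by (intro finite_subset[OF _ finite_divisors_nat[of q]]) auto
  have "main_M Q0 P q = (\<Sum>d\<in>?D. F d)" by (simp add: main_M_def F_def roots4_def)
  \<comment> \<open>Here \<open>Q0 > 1\<close> guarantees that 1 lies in \<open>?D\<close>.\<close>
  also have "\<dots> = F 1 + (\<Sum>d\<in>?D - {1}. F d)" using fin Q0 by (intro sum.remove) auto
  also have "F 1 = beta q * real (card P)" by (simp add: F_def Xi_def beta_eq[OF q])
  finally have "\<bar>main_M Q0 P q - beta q * real (card P)\<bar> = \<bar>\<Sum>d\<in>?D - {1}. F d\<bar>" by simp
  also have "\<dots> \<le> (\<Sum>d\<in>?D - {1}. \<bar>F d\<bar>)" by (rule sum_abs)
  also have "\<dots> \<le> (\<Sum>d\<in>?D - {1}. K * real (card P) * Y powr (-\<Theta>) * (8 ^ num_primes q *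
      (real d powr (C0 + 2) / real (q div d))))"
  proof (intro sum_mono)
    fix d assume "d \<in> ?D - {1}"
    then have d: "d dvd q" "d \<noteq> 1" by auto
    have qd: "q = d * (q div d)" using d by simp
    have sq: "squarefree d" "squarefree (q div d)" using q qd squarefree_multD by metis+
    have pos: "d > 0" "q div d > 0" using q0 qd by (metis mult_0 mult_0_right neq0_conv)+
    have cop: "coprime d (q div d)"
    proof (rule coprimeI)
      fix c assume "c dvd d" "c dvd q div d"
      then have "c\<^sup>2 dvd q" using qd by (metis mult_dvd_mono power2_eq_square)
      then show "is_unit c" using q squarefreeD by blast
    qed
    have np: "num_primes q = num_primes d + num_primes (q div d)"
      using num_primes_mult[OF pos cop] qd by simp
    define E where "E = K * real (card P) * real d powr C0 * Y powr (-\<Theta>) * (4 ^ num_primes d * (real d)\<^sup>2)"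
    have "\<bar>F d\<bar> \<le> (\<Sum>\<tau>\<in>roots4 q. \<bar>\<Sum>\<phi>\<in>P. Xi d (ff \<phi> - \<tau>)\<bar> * rho (q div d))"
      unfolding F_def
      by (rule order_trans[OF sum_abs]) (simp add: abs_mult rho_nonneg flip: sum_distrib_right)
    also have "\<dots> \<le> (\<Sum>\<tau>\<in>roots4 q. E * rho (q div d))"
    proof (intro sum_mono mult_right_mono rho_nonneg)
      fix \<tau> assume "\<tau> \<in> roots4 q"
      then have "[\<tau>\<^sup>2 = 4] (mod int q)" by (simp add: roots4_def)
      then have "[\<tau>\<^sup>2 = 4] (mod int d)" using d(1) by (meson cong_dvd_modulus of_nat_dvd_iff)
      then show "\<bar>\<Sum>\<phi>\<in>P. Xi d (ff \<phi> - \<tau>)\<bar> \<le> E"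
        unfolding P_def E_def by (rule sum_Xi_prod_set_bound[OF eq K X Z \<AA> sq(1) d(2)])
    qed
    also have "\<dots> = real (card (roots4 q)) * (E * rho (q div d))" by simp
    also have "\<dots> \<le> 2 ^ num_primes q * (E * (2 ^ num_primes (q div d) / real (q div d)))"
    proof (intro mult_mono mult_left_mono rho_le[OF sq(2)])
      show "real (card (roots4 q)) \<le> 2 ^ num_primes q"
        using card_roots4_le[OF q] by (metis of_nat_le_iff of_nat_numeral of_nat_power)
      show "0 \<le> E" using K by (simp add: E_def)
      then show "0 \<le> E * rho (q div d)" using rho_nonneg by simp
    qed (simp_all add: rho_nonneg)
    also have "\<dots> = (2 ^ num_primes q * 4 ^ num_primes d * 2 ^ num_primes (q div d)) *
        (K * real (card P) * Y powr (-\<Theta>) * (real d powr (C0 + 2) / real (q div d)))"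
      using pos(1) by (simp add: E_def powr_add)
    also have "\<dots> \<le> 8 ^ num_primes q *
        (K * real (card P) * Y powr (-\<Theta>) * (real d powr (C0 + 2) / real (q div d)))"
    proof (intro mult_right_mono)
      \<comment> \<open>Rounding the base 2 up to 4 lets the powers at d and \<open>q div d\<close>
        merge into \<open>4 ^ num_primes q\<close>.\<close>
      have "(2::real) ^ num_primes (q div d) \<le> 4 ^ num_primes (q div d)" by (rule power_mono) auto
      then have "2 ^ num_primes q * 4 ^ num_primes d * 2 ^ num_primes (q div d) \<le>
          2 ^ num_primes q * 4 ^ num_primes d * (4 ^ num_primes (q div d) :: real)" by simp
      also have "\<dots> = 2 ^ num_primes q * 4 ^ num_primes q" by (simp add: np power_add)
      also have "\<dots> = 8 ^ num_primes q" by (simp flip: power_mult_distrib)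
      finally show "2 ^ num_primes q * 4 ^ num_primes d * 2 ^ num_primes (q div d) \<le> (8::real) ^ num_primes q" .
    qed (use K in simp)
    finally show "\<bar>F d\<bar> \<le> K * real (card P) * Y powr (-\<Theta>) * (8 ^ num_primes q *
      (real d powr (C0 + 2) / real (q div d)))" by (simp add: mult_ac)
  qed
  also have "\<dots> \<le> (\<Sum>d\<in>?D. K * real (card P) * Y powr (-\<Theta>) * (8 ^ num_primes q *
      (real d powr (C0 + 2) / real (q div d))))"
    using fin K by (intro sum_mono2) auto
  finally show ?thesis by (simp add: sum_distrib_left)
qed

text \<open>The constant is \<open>K * C1 * C2\<close>, where \<open>C1\<close> and
  \<open>C2\<close> come from bounds involving only \<open>\<epsilon>\<close>; it is therefore
  uniform in X, Y, Z, \<open>Q0\<close> and the sets.\<close>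

theorem theorem4p1:
  fixes A :: nat and C0 \<Theta> K c \<epsilon> :: real
  assumes "A \<ge> 1" and "C0 > 0" and "\<Theta> > 0" and "K > 0" and "c > 0" and "\<epsilon> > 0"
  shows "\<exists>C>0. \<forall>(X::real) (Y::real) (Z::real) (N::real) (Q0::real) \<AA> \<Omega>X \<Omega>Z.
           X \<ge> 1 \<and> Y \<ge> 1 \<and> Z \<ge> 1 \<and> X * Y * Z = N \<and> Q0 > 1 \<and>
           \<AA> \<noteq> {} \<and> \<AA> \<subseteq> Gamma_semi 2 \<inter> norm_ball Y \<and>
           equidistributed C0 \<Theta> K Y \<AA> \<and>
           Omega_set A c X \<Omega>X \<and> Omega_set A c Z \<Omega>Z \<longrightarrow>
           (\<exists>r :: nat \<Rightarrow> real.
              (\<forall>q. squarefree q \<longrightarrow>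
                 main_M Q0 (prod_set \<Omega>X \<AA> \<Omega>Z) q
                   = beta q * real (card (prod_set \<Omega>X \<AA> \<Omega>Z)) + r q) \<and>
              (\<forall>\<Q>\<ge>1. (\<Sum>q\<in>{q. squarefree q \<and> real q < \<Q>}. \<bar>r q\<bar>)
                 \<le> C * real (card (prod_set \<Omega>X \<AA> \<Omega>Z)) * \<Q> powr \<epsilon>
                     * Q0 powr (C0 + 3) * Y powr (-\<Theta>)))"
proof -
  \<comment> \<open>One half of \<open>\<epsilon>\<close> absorbs \<open>8 ^ num_primes q\<close>,
    the other half the harmonic sum over cofactors.\<close>
  have e2: "\<epsilon> / 2 > 0" using assms by simp
  obtain C1 where C1: "C1 > 0" "\<And>n. squarefree n \<Longrightarrow> 8 ^ num_primes n \<le> C1 * real n powr (\<epsilon> / 2)"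
    using power_num_primes_le[OF e2, of 8] by auto
  obtain C2 where C2: "C2 > 0"
    "\<And>x. x \<ge> 1 \<Longrightarrow> (\<Sum>m\<in>{m::nat. real m < x \<and> m \<ge> 1}. 1 / real m) \<le> C2 * x powr (\<epsilon> / 2)"
    using harmonic_sum_le[OF e2] by blast
  show ?thesis
  proof (intro exI[of _ "K * C1 * C2"] conjI allI impI)
    show "0 < K * C1 * C2" using assms C1 C2 by simp
    fix X Y Z N Q0 :: real and \<AA> \<Omega>X \<Omega>Z
    assume h: "X \<ge> 1 \<and> Y \<ge> 1 \<and> Z \<ge> 1 \<and> X * Y * Z = N \<and> Q0 > 1 \<and>
           \<AA> \<noteq> {} \<and> \<AA> \<subseteq> Gamma_semi 2 \<inter> norm_ball Y \<and>
           equidistributed C0 \<Theta> K Y \<AA> \<and>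
           Omega_set A c X \<Omega>X \<and> Omega_set A c Z \<Omega>Z"
    define P where "P = prod_set \<Omega>X \<AA> \<Omega>Z"
    define r where "r q = main_M Q0 P q - beta q * real (card P)" for q
    obtain l l' where ll: "\<Omega>X \<subseteq> Gamma_words A l" "\<Omega>Z \<subseteq> Gamma_words A l'"
      using h unfolding Omega_set_def by blast
    have \<AA>: "\<AA> \<subseteq> Gamma_semi 2" "finite \<AA>" and Q0: "Q0 > 1"
      and \<Omega>: "\<Omega>X \<subseteq> Gamma_semi A" "\<Omega>Z \<subseteq> Gamma_semi A" and eq: "equidistributed C0 \<Theta> K Y \<AA>"
      using h finite_subset[OF _ finite_norm_ball[of Y], of \<AA>] unfolding Omega_set_def by auto
    have "(\<Sum>q\<in>{q. squarefree q \<and> real q < \<Q>}. \<bar>r q\<bar>)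
         \<le> K * C1 * C2 * real (card P) * \<Q> powr \<epsilon> * Q0 powr (C0 + 3) * Y powr (-\<Theta>)"
      if Q: "\<Q> \<ge> 1" for \<Q>
    proof -
      define G where "G = K * real (card P) * Y powr (-\<Theta>) * (C1 * \<Q> powr (\<epsilon> / 2))"
      have G0: "G \<ge> 0" using assms C1 by (simp add: G_def)
      define T where "T q = (\<Sum>d\<in>{d. d dvd q \<and> real d < Q0}. real d powr (C0 + 2) / real (q div d))" for q
      have "(\<Sum>q\<in>{q. squarefree q \<and> real q < \<Q>}. \<bar>r q\<bar>) \<le> (\<Sum>q\<in>{q. squarefree q \<and> real q < \<Q>}. G * T q)"
      proof (intro sum_mono)
        fix q assume "q \<in> {q. squarefree q \<and> real q < \<Q>}"
        then have q: "squarefree q" "real q < \<Q>" by auto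
        have T0: "T q \<ge> 0" unfolding T_def by (intro sum_nonneg) simp
        have "\<bar>r q\<bar> \<le> K * real (card P) * Y powr (-\<Theta>) * (8 ^ num_primes q * T q)"
          unfolding r_def P_def T_def
          by (rule main_M_error_bound[OF eq assms(4) Q0 ll(1) \<Omega>(1) ll(2) \<Omega>(2) \<AA> q(1)])
        also have "8 ^ num_primes q \<le> C1 * \<Q> powr (\<epsilon> / 2)"
        proof -
          have "real q powr (\<epsilon> / 2) \<le> \<Q> powr (\<epsilon> / 2)" using q e2 by (intro powr_mono2) auto
          then show ?thesis using C1(2)[OF q(1)] C1(1) by (meson mult_left_mono order_less_imp_le order_trans)
        qed
        finally show "\<bar>r q\<bar> \<le> G * T q"
          using T0 assms by (simp add: G_def mult.assoc mult_left_mono mult_right_mono)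
      qed
      also have "\<dots> = G * (\<Sum>q\<in>{q. squarefree q \<and> real q < \<Q>}. T q)" by (simp add: sum_distrib_left)
      also have "\<dots> \<le> G * (Q0 powr (C0 + 3) * (C2 * \<Q> powr (\<epsilon> / 2)))"
      proof (intro mult_left_mono G0)
        have "(\<Sum>q\<in>{q. squarefree q \<and> real q < \<Q>}. T q) \<le>
            Q0 powr (C0 + 2 + 1) * (\<Sum>m\<in>{m::nat. real m < \<Q> \<and> m \<ge> 1}. 1 / real m)"
          unfolding T_def using assms by (intro divisor_pair_sum_le[OF Q Q0]) simp
        also have "\<dots> \<le> Q0 powr (C0 + 2 + 1) * (C2 * \<Q> powr (\<epsilon> / 2))"
          by (intro mult_left_mono C2(2)[OF Q]) simp
        finally show "(\<Sum>q\<in>{q. squarefree q \<and> real q < \<Q>}. T q) \<le> Q0 powr (C0 + 3) * (C2 * \<Q> powr (\<epsilon> / 2))"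
          by (simp add: add.commute)
      qed
      also have "\<dots> = K * C1 * C2 * real (card P) * (\<Q> powr (\<epsilon> / 2) * \<Q> powr (\<epsilon> / 2)) * Q0 powr (C0 + 3) * Y powr (-\<Theta>)"
        by (simp add: G_def mult_ac)
      also have "\<Q> powr (\<epsilon> / 2) * \<Q> powr (\<epsilon> / 2) = \<Q> powr \<epsilon>" by (simp flip: powr_add)
      finally show ?thesis .
    qed
    then show "\<exists>r :: nat \<Rightarrow> real.
              (\<forall>q. squarefree q \<longrightarrow>
                 main_M Q0 (prod_set \<Omega>X \<AA> \<Omega>Z) q
                   = beta q * real (card (prod_set \<Omega>X \<AA> \<Omega>Z)) + r q) \<and>
              (\<forall>\<Q>\<ge>1. (\<Sum>q\<in>{q. squarefree q \<and> real q < \<Q>}. \<bar>r q\<bar>)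
                 \<le> K * C1 * C2 * real (card (prod_set \<Omega>X \<AA> \<Omega>Z)) * \<Q> powr \<epsilon>
                     * Q0 powr (C0 + 3) * Y powr (-\<Theta>))"
      unfolding P_def[symmetric] by (intro exI[of _ r]) (simp add: r_def)
  qed
qed

end
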